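(* For any nondegenerate rounding $\Phi:(\mathbb{R}^m,0)\to(\mathbb{R}^n,0)$ there exists a rounding $(\mathbb{R}^m,0)\to(\mathbb{R}^n,0)$ that is equivalent to $\Phi$ and that factors through a quadratic map $f:S^m\to S^n$ between unit spheres.
   Context: $\mathbb{R}^n$ carries the Euclidean inner product $\langle\cdot,\cdot\rangle$. A circle in a Euclidean space means a round Euclidean circle, or a straight line, or a point. A vector line is a line passing through the origin. A rounding is a germ at $0$ of a real analytic map $\Phi:(\mathbb{R}^m,0)\to(\mathbb{R}^n,0)$ (so $\Phi(0)=0$) that takes every germ at $0$ of a vector line to a germ of a circle, i.e. the image of each such germ is contained in a circle. The rank of a rounding is the rank of its first differential at $0$; standing assumption: every rounding has rank at least $2$. Two roundings $\Phi_1,\Phi_2$ are equivalent if for every germ at $0$ of a vector line $l$ the germs $\Phi_1(l)$ and $\Phi_2(l)$ belong to the same circle. For a rounding $\Phi$ with 2-jet $A+B$ at $0$ ($A$ linear, $B$ homogeneous quadratic), the polynomials $\langle A,B\rangle:x\mapsto\langle A(x),B(x)\rangle$ and $\langle B,B\rangle:x\mapsto\langle B(x),B(x)\rangle$ are divisible by $\langle A,A\rangle:x\mapsto\langle A(x),A(x)\rangle$; put $p=\langle A,B\rangle/\langle A,A\rangle$ (a linear form) and $q=\langle B,B\rangle/\langle A,A\rangle$ (a quadratic form). The rounding $\Phi$ is degenerate if there is a point $x_0\in\mathbb{R}^m$, $x_0\neq 0$, such that $A(x_0)=0$ and $q(x_0)=p(x_0)^2$; otherwise it is nondegenerate. The unit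 sphere $S^k$ is the set of vectors of Euclidean length 1 in $\mathbb{R}^{k+1}$. A map $f:S^m\to S^n$ is quadratic if it extends to a homogeneous quadratic map $\mathbb{R}^{m+1}\to\mathbb{R}^{n+1}$. A map $\phi$ of an open subset $U\subseteq\mathbb{R}^m$ to $\mathbb{R}^n$ factors through $f:S^m\to S^n$ if $\phi$ is obtained as the composition, in this order, of: an affine embedding of $U\subseteq\mathbb{R}^m$ into $\mathbb{R}^{m+1}\setminus\{0\}$; the radial projection $\mathbb{R}^{m+1}\setminus\{0\}\to S^m$; the map $f:S^m\to S^n$; a stereographic projection of $S^n$ to some hyperplane $H$ in $\mathbb{R}^{n+1}$; a Euclidean (isometric) identification of $H$ with $\mathbb{R}^n$. A rounding, being a germ at $0$, factors through $f$ if it is represented by such a $\phi$ on some open neighborhood $U$ of $0$. *)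

theory Defs
  imports "HOL-Analysis.Analysis"
begin

text \<open>
  A germ at \<open>0\<close> is represented by a total function of which only the values near \<open>0\<close> matter:
  every notion of germs below depends only on those values.  The space \<open>\<real>\<close> to the power \<open>m + 1\<close> is
  \<open>(real^'m) \<times> real\<close>, whose product norm is the Euclidean one.
\<close>

subsection \<open>Circles and vector lines\<close>

definition is_circle :: "'a::euclidean_space set \<Rightarrow> bool" where
  "is_circle C \<longleftrightarrow>
     (\<exists>P c r. affine P \<and> aff_dim P = 2 \<and> c \<in> P \<and> r > 0 \<and> C = sphere c r \<inter> P) \<or>
     (affine C \<and> aff_dim C = 1) \<or>
     (\<exists>a. C = {a})"

definition vector_line :: "'a::euclidean_space set \<Rightarrow> bool" where
  "vector_line l \<longleftrightarrow> subspace l \<and> dim l = 1"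

text \<open>The image of the germ of \<open>l\<close> at \<open>0\<close> is contained in \<open>C\<close>.\<close>

definition germ_image_in :: "('a::euclidean_space \<Rightarrow> 'b) \<Rightarrow> 'a set \<Rightarrow> 'b set \<Rightarrow> bool" where
  "germ_image_in \<Phi> l C \<longleftrightarrow> (\<forall>\<^sub>F x in nhds 0. x \<in> l \<longrightarrow> \<Phi> x \<in> C)"


subsection \<open>Roundings\<close>

text \<open>
  \<open>\<alpha> :: 'm \<Rightarrow> nat\<close> is a multi-index, \<open>c\<close> the family of (vector) coefficients of a power series
  converging (unconditionally, hence absolutely) on a neighbourhood of \<open>0\<close>.
\<close>

definition real_analytic_at_0 :: "(real^'m \<Rightarrow> real^'n) \<Rightarrow> bool" where
  "real_analytic_at_0 \<Phi> \<longleftrightarrow>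
     (\<exists>(c :: ('m \<Rightarrow> nat) \<Rightarrow> real^'n) r. r > 0 \<and>
        (\<forall>x. norm x < r \<longrightarrow>
           ((\<lambda>\<alpha>. (\<Prod>i\<in>UNIV. (x $ i) ^ \<alpha> i) *\<^sub>R c \<alpha>) has_sum \<Phi> x) UNIV))"

definition rounding :: "(real^'m \<Rightarrow> real^'n) \<Rightarrow> bool" where
  "rounding \<Phi> \<longleftrightarrow>
     real_analytic_at_0 \<Phi> \<and> \<Phi> 0 = 0 \<and>
     (\<forall>l. vector_line l \<longrightarrow> (\<exists>C. is_circle C \<and> germ_image_in \<Phi> l C)) \<and>
     dim (range (frechet_derivative \<Phi> (at 0))) \<ge> 2"

definition equivalent_roundings :: "(real^'m \<Rightarrow> real^'n) \<Rightarrow> (real^'m \<Rightarrow> real^'n) \<Rightarrow> bool" where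
  "equivalent_roundings \<Phi>1 \<Phi>2 \<longleftrightarrow>
     (\<forall>l. vector_line l \<longrightarrow>
        (\<exists>C. is_circle C \<and> germ_image_in \<Phi>1 l C \<and> germ_image_in \<Phi>2 l C))"


subsection \<open>Nondegeneracy\<close>

definition homogeneous_quadratic :: "('a::real_vector \<Rightarrow> 'b::real_vector) \<Rightarrow> bool" where
  "homogeneous_quadratic Q \<longleftrightarrow> (\<exists>b. bilinear b \<and> (\<forall>x. Q x = b x x))"

text \<open>\<open>\<Phi>(x) = A(x) + B(x) + o(|x|\<^sup>2)\<close>; this determines \<open>A\<close> and \<open>B\<close> uniquely.\<close>

definition has_2jet ::
    "(real^'m \<Rightarrow> real^'n) \<Rightarrow> (real^'m \<Rightarrow> real^'n) \<Rightarrow> (real^'m \<Rightarrow> real^'n) \<Rightarrow> bool" where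
  "has_2jet \<Phi> A B \<longleftrightarrow> \<Phi> 0 = 0 \<and> linear A \<and> homogeneous_quadratic B \<and>
     ((\<lambda>x. (\<Phi> x - A x - B x) /\<^sub>R (norm x)\<^sup>2) \<longlongrightarrow> 0) (at 0)"

text \<open>
  The quotients \<open>p\<close> and \<open>q\<close> of polynomials are given by the products they satisfy; as \<open>A \<noteq> 0\<close> for
  a rounding, these determine \<open>p\<close> and \<open>q\<close> uniquely.
\<close>

definition degenerate :: "(real^'m \<Rightarrow> real^'n) \<Rightarrow> bool" where
  "degenerate \<Phi> \<longleftrightarrow>
     (\<exists>A B (p :: real^'m \<Rightarrow> real) (q :: real^'m \<Rightarrow> real).
        has_2jet \<Phi> A B \<and> linear p \<and> homogeneous_quadratic q \<and>
        (\<forall>x. A x \<bullet> B x = p x * (A x \<bullet> A x)) \<and>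
        (\<forall>x. B x \<bullet> B x = q x * (A x \<bullet> A x)) \<and>
        (\<exists>x0. x0 \<noteq> 0 \<and> A x0 = 0 \<and> q x0 = (p x0)\<^sup>2))"


subsection \<open>Factoring through maps between spheres\<close>

definition quadratic_sphere_map ::
    "('a::euclidean_space \<Rightarrow> 'b::euclidean_space) \<Rightarrow> bool" where
  "quadratic_sphere_map f \<longleftrightarrow>
     f ` sphere 0 1 \<subseteq> sphere 0 1 \<and>
     (\<exists>F. homogeneous_quadratic F \<and> (\<forall>x \<in> sphere 0 1. f x = F x))"

definition affine_embedding :: "('a::real_vector \<Rightarrow> 'b::real_vector) \<Rightarrow> bool" where
  "affine_embedding E \<longleftrightarrow> (\<exists>L a. linear L \<and> inj L \<and> (\<forall>x. E x = a + L x))"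

text \<open>
  Stereographic projection of the unit sphere from its point \<open>N\<close> to the hyperplane
  \<open>{z. N \<bullet> z = d}\<close>, which is orthogonal to \<open>N\<close> and, for \<open>d \<noteq> 1\<close>, does not contain \<open>N\<close>: the value
  is the point where the line through \<open>N\<close> and \<open>y\<close> meets this hyperplane.  Meaningful for \<open>y \<noteq> N\<close>.
\<close>

definition stereographic :: "'a::euclidean_space \<Rightarrow> real \<Rightarrow> 'a \<Rightarrow> 'a" where
  "stereographic N d y = N + ((1 - d) / (1 - N \<bullet> y)) *\<^sub>R (y - N)"

definition isometric_identification ::
    "'a::euclidean_space set \<Rightarrow> ('a \<Rightarrow> 'b::euclidean_space) \<Rightarrow> bool" where
  "isometric_identification H \<iota> \<longleftrightarrow>
     bij_betw \<iota> H UNIV \<and> (\<forall>y\<in>H. \<forall>z\<in>H. dist (\<iota> y) (\<iota> z) = dist y z)"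

text \<open>The radial projection to the unit sphere is \<^const>\<open>sgn\<close>.\<close>

definition factors_through_on ::
    "(real^'m) set \<Rightarrow> (real^'m \<Rightarrow> real^'n) \<Rightarrow>
     ((real^'m) \<times> real \<Rightarrow> (real^'n) \<times> real) \<Rightarrow> bool" where
  "factors_through_on U \<phi> f \<longleftrightarrow>
     (\<exists>E N d \<iota>.
        affine_embedding E \<and> (\<forall>x\<in>U. E x \<noteq> 0) \<and>
        norm N = 1 \<and> d \<noteq> 1 \<and> (\<forall>x\<in>U. f (sgn (E x)) \<noteq> N) \<and>
        isometric_identification {z. N \<bullet> z = d} \<iota> \<and>
        (\<forall>x\<in>U. \<phi> x = \<iota> (stereographic N d (f (sgn (E x))))))"

definition germ_factors_through ::
    "(real^'m \<Rightarrow> real^'n) \<Rightarrow> ((real^'m) \<times> real \<Rightarrow> (real^'n) \<times> real) \<Rightarrow> bool" where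
  "germ_factors_through \<Phi> f \<longleftrightarrow> (\<exists>U. open U \<and> 0 \<in> U \<and> factors_through_on U \<Phi> f)"

end

theory Submission
  imports Defs "HOL-Library.Landau_Symbols" "HOL-Computational_Algebra.Polynomial"
begin

text \<open>
  Let \<open>A + B + C + D + \<dots>\<close> be the homogeneous expansion of \<open>\<Phi>\<close>.  Comparing coefficients in the
  equation of the circle containing \<open>t \<mapsto> \<Phi> (t x)\<close> shows that \<open>C(x)\<close> and \<open>D(x)\<close> are combinations
  \<open>\<alpha> A(x) + \<beta> B(x)\<close> and \<open>\<gamma> A(x) + \<delta> B(x)\<close> with \<open>2\<langle>A,B\<rangle> = \<beta>\<langle>A,A\<rangle>\<close> and
  \<open>\<langle>B,B\<rangle> + 2\<langle>A,C\<rangle> = \<delta>\<langle>A,A\<rangle>\<close>.  Read at the complex zeros of \<open>\<langle>A,A\<rangle>\<close> on a plane, these identities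
  force \<open>\<langle>A,B\<rangle>\<close> and \<open>\<langle>B,B\<rangle>\<close> to vanish there, so \<open>p = \<langle>A,B\<rangle>/\<langle>A,A\<rangle>\<close> and \<open>q = \<langle>B,B\<rangle>/\<langle>A,A\<rangle>\<close> are
  polynomial.

  Replacing \<open>B\<close> by \<open>B' = B - p A\<close> and \<open>q\<close> by \<open>Q = q - p\<^sup>2\<close> makes \<open>B'\<close> orthogonal to \<open>A\<close> with
  \<open>|B'|\<^sup>2 = Q |A|\<^sup>2\<close>, and \<open>\<Psi> = (A + B') / (1 + Q)\<close> lies on the same circles as \<open>\<Phi>\<close>.  Inverse
  stereographic projection followed by homogenisation turns \<open>\<Psi>\<close> into the quadratic map
  \<open>F(x,t) = (2(tA + B'), |A|\<^sup>2 - t\<^sup>2 - Q)\<close>, whose norm is the quadratic form \<open>t\<^sup>2 + Q + |A|\<^sup>2\<close>.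
  Nondegeneracy says that this form is positive definite, so a linear change of coordinates turns it
  into the squared Euclidean norm.
\<close>


subsection \<open>Homogeneous expansions and jets\<close>

definition monomial_at :: "real^'m \<Rightarrow> ('m \<Rightarrow> nat) \<Rightarrow> real" where
  "monomial_at x \<alpha> = (\<Prod>i\<in>UNIV. (x $ i) ^ \<alpha> i)"

definition homogeneous_part :: "(('m \<Rightarrow> nat) \<Rightarrow> real^'n) \<Rightarrow> nat \<Rightarrow> real^'m \<Rightarrow> real^'n" where
  "homogeneous_part c k x = (\<Sum>\<alpha> | sum \<alpha> UNIV = k. monomial_at x \<alpha> *\<^sub>R c \<alpha>)"

lemma finite_multi_indices: "finite {\<alpha> :: 'm::finite \<Rightarrow> nat. sum \<alpha> UNIV = k}"
proof (rule finite_subset)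
  show "{\<alpha> :: 'm \<Rightarrow> nat. sum \<alpha> UNIV = k} \<subseteq> PiE UNIV (\<lambda>_. {..k})"
    by (auto simp: PiE_def extensional_def intro: member_le_sum)
qed (simp add: finite_PiE)

lemma monomial_at_scaleR: "monomial_at (t *\<^sub>R x) \<alpha> = t ^ sum \<alpha> UNIV * monomial_at x \<alpha>"
  by (simp add: monomial_at_def power_mult_distrib prod.distrib power_sum)

lemma homogeneous_part_scaleR:
  "homogeneous_part c k (t *\<^sub>R x) = t ^ k *\<^sub>R homogeneous_part c k x"
  by (simp add: homogeneous_part_def monomial_at_scaleR scaleR_sum_right)

lemma abs_monomial_at_le:
  assumes "\<And>i. \<bar>x $ i\<bar> \<le> s"
  shows "\<bar>monomial_at x \<alpha>\<bar> \<le> s ^ sum \<alpha> UNIV"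
proof -
  have "\<bar>monomial_at x \<alpha>\<bar> = (\<Prod>i\<in>UNIV. \<bar>x $ i\<bar> ^ \<alpha> i)"
    by (simp add: monomial_at_def abs_prod power_abs)
  also have "\<dots> \<le> (\<Prod>i\<in>UNIV. s ^ \<alpha> i)"
    by (intro prod_mono conjI power_mono) (use assms in auto)
  finally show ?thesis by (simp add: power_sum)
qed

text \<open>In finite dimension unconditional convergence is absolute: each coordinate is absolutely
  summable over the reals, and the sum of the absolute coordinates dominates the norm.\<close>

lemma summable_on_norm_vec:
  fixes f :: "'a \<Rightarrow> real^'n"
  assumes "f summable_on S"
  shows "(\<lambda>a. norm (f a)) summable_on S"
proof -
  have abs: "(\<lambda>a. \<bar>f a $ i\<bar>) summable_on S" for i
    using iffD1[OF summable_on_iff_abs_summable_on_real summable_on_bounded_linear[OF bounded_linear_vec_nth assms, of i]]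
    by simp
  have "(\<lambda>a. \<Sum>i\<in>F. \<bar>f a $ i\<bar>) summable_on S" if "finite F" for F
    using that by (induction F rule: finite_induct) (auto intro: summable_on_add abs)
  from this[of UNIV] show ?thesis
    by (rule summable_on_comparison_test) (auto simp: norm_le_l1_cart)
qed

lemma norm_vec_const: "norm ((\<chi> i. s) :: real^'m) = sqrt (CARD('m)) * \<bar>s\<bar>"
  by (simp add: norm_vec_def L2_set_def real_sqrt_mult)

text \<open>Taylor remainder bound. Absolute convergence at the single diagonal point with all
  coordinates \<open>\<rho>\<close> dominates the terms of degree at least \<open>n\<close> on the
  whole ball of radius \<open>\<rho>\<close>, with a factor \<open>(norm x / \<rho>) ^ n\<close> to
  spare.\<close>

lemma power_series_jet:
  fixes \<Phi> :: "real^'m \<Rightarrow> real^'n"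
  assumes r: "r > 0"
    and ser: "\<And>x. norm x < r \<Longrightarrow> ((\<lambda>\<alpha>. monomial_at x \<alpha> *\<^sub>R c \<alpha>) has_sum \<Phi> x) UNIV"
  shows "\<exists>K \<rho>. \<rho> > 0 \<and>
    (\<forall>x. norm x \<le> \<rho> \<longrightarrow> norm (\<Phi> x - (\<Sum>k<n. homogeneous_part c k x)) \<le> K * norm x ^ n)"
proof -
  \<comment> \<open>The vector with all coordinates \<open>\<rho>\<close> then has norm
    \<open>r / 2\<close>, inside the region of convergence.\<close>
  define \<rho> where "\<rho> = r / (2 * sqrt (CARD('m)))"
  define M where "M = infsum (\<lambda>\<alpha>. \<rho> ^ sum \<alpha> UNIV * norm (c \<alpha>)) UNIV"
  have \<rho>: "\<rho> > 0" using r by (simp add: \<rho>_def)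
  have "norm ((\<chi> i. \<rho>) :: real^'m) < r"
    using r by (simp add: norm_vec_const \<rho>_def)
  from has_sum_imp_summable[OF ser[OF this]]
  have "(\<lambda>\<alpha>. norm (monomial_at (\<chi> i. \<rho>) \<alpha> *\<^sub>R c \<alpha>)) summable_on UNIV"
    by (rule summable_on_norm_vec)
  moreover have "monomial_at (\<chi> i. \<rho>) \<alpha> = \<rho> ^ sum \<alpha> UNIV" for \<alpha> :: "'m \<Rightarrow> nat"
    by (simp add: monomial_at_def power_sum)
  ultimately have sm: "(\<lambda>\<alpha>. \<rho> ^ sum \<alpha> UNIV * norm (c \<alpha>)) summable_on UNIV"
    using \<rho> by simp
  have \<rho>r: "\<rho> < r"
  proof -
    have "1 \<le> sqrt (CARD('m))" by (simp add: Suc_leI)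
    then have "1 < 2 * sqrt (CARD('m))" by linarith
    then show ?thesis unfolding \<rho>_def using r by (simp add: divide_less_eq)
  qed
  have "norm (\<Phi> x - (\<Sum>k<n. homogeneous_part c k x)) \<le> (M / \<rho> ^ n) * norm x ^ n"
    if x: "norm x \<le> \<rho>" for x
  proof -
    let ?T = "\<lambda>\<alpha>. monomial_at x \<alpha> *\<^sub>R c \<alpha>"
    let ?lo = "{\<alpha> :: 'm \<Rightarrow> nat. sum \<alpha> UNIV < n}" and ?hi = "{\<alpha> :: 'm \<Rightarrow> nat. n \<le> sum \<alpha> UNIV}"
    have lo_eq: "?lo = (\<Union>k\<in>{..<n}. {\<alpha>. sum \<alpha> UNIV = k})" by auto
    have fin: "finite ?lo" unfolding lo_eq by (intro finite_UN_I finite_multi_indices) auto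
    have "sum ?T ?lo = (\<Sum>k<n. homogeneous_part c k x)"
      unfolding lo_eq homogeneous_part_def
      by (rule sum.UNION_disjoint) (auto simp: finite_multi_indices)
    then have lo: "(?T has_sum (\<Sum>k<n. homogeneous_part c k x)) ?lo"
      using has_sum_finite[OF fin, of ?T] by simp
    have all: "(?T has_sum \<Phi> x) UNIV" using ser x \<rho>r by simp
    have "?T summable_on ?hi"
      using has_sum_imp_summable[OF all] by (rule summable_on_subset_banach) auto
    then obtain R where hi: "(?T has_sum R) ?hi" by (auto simp: summable_on_def)
    have "(?T has_sum ((\<Sum>k<n. homogeneous_part c k x) + R)) (?lo \<union> ?hi)"
      by (rule has_sum_Un_disjoint[OF lo hi]) auto
    moreover have "?lo \<union> ?hi = UNIV" by auto
    ultimately have R: "R = \<Phi> x - (\<Sum>k<n. homogeneous_part c k x)"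
      using all has_sum_unique by (metis add_diff_cancel_left')
    \<comment> \<open>The degree of \<open>\<alpha>\<close> is at least \<open>n\<close> and
      \<open>norm x / \<rho>\<close> is at most 1, so lowering the exponent of this ratio to
      \<open>n\<close> can only enlarge the bound.\<close>
    have bnd: "norm (?T \<alpha>) \<le> (norm x / \<rho>) ^ n * (\<rho> ^ sum \<alpha> UNIV * norm (c \<alpha>))"
      if "\<alpha> \<in> ?hi" for \<alpha>
    proof -
      have "\<bar>monomial_at x \<alpha>\<bar> \<le> norm x ^ sum \<alpha> UNIV"
        by (rule abs_monomial_at_le) (rule component_le_norm_cart)
      also have "\<dots> = (norm x / \<rho>) ^ sum \<alpha> UNIV * \<rho> ^ sum \<alpha> UNIV"
        using \<rho> by (simp add: power_divide)
      also have "(norm x / \<rho>) ^ sum \<alpha> UNIV \<le> (norm x / \<rho>) ^ n"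
        by (rule power_decreasing) (use that x \<rho> in auto)
      finally have "\<bar>monomial_at x \<alpha>\<bar> \<le> (norm x / \<rho>) ^ n * \<rho> ^ sum \<alpha> UNIV"
        using \<rho> by (simp add: mult_right_mono)
      then show ?thesis by (simp add: mult.assoc[symmetric] mult_right_mono)
    qed
    have sm': "(\<lambda>\<alpha>. (norm x / \<rho>) ^ n * (\<rho> ^ sum \<alpha> UNIV * norm (c \<alpha>))) summable_on UNIV"
      by (intro summable_on_cmult_right sm)
    have "norm R \<le> infsum (\<lambda>\<alpha>. (norm x / \<rho>) ^ n * (\<rho> ^ sum \<alpha> UNIV * norm (c \<alpha>))) ?hi"
      by (rule norm_infsum_le[OF hi _ bnd])
        (use summable_on_subset_banach[OF sm'] in auto)
    also have "\<dots> \<le> infsum (\<lambda>\<alpha>. (norm x / \<rho>) ^ n * (\<rho> ^ sum \<alpha> UNIV * norm (c \<alpha>))) UNIV"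
      by (rule infsum_mono2) (use summable_on_subset_banach[OF sm'] sm' \<rho> in auto)
    also have "\<dots> = (norm x / \<rho>) ^ n * M" unfolding M_def by (rule infsum_cmult_right) (use sm in auto)
    finally show ?thesis unfolding R by (simp add: power_divide mult.commute)
  qed
  with \<rho> show ?thesis by blast
qed

section \<open>Algebraic form of the homogeneous parts\<close>

lemma homogeneous_quadratic_sum:
  assumes "\<And>i. i \<in> F \<Longrightarrow> homogeneous_quadratic (Q i)"
  shows "homogeneous_quadratic (\<lambda>x. \<Sum>i\<in>F. Q i x)"
proof -
  from assms obtain b where b: "\<And>i. i \<in> F \<Longrightarrow> bilinear (b i) \<and> (\<forall>x. Q i x = b i x x)"
    unfolding homogeneous_quadratic_def by metis
  have "bilinear (\<lambda>x y. \<Sum>i\<in>F. b i x y)"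
    unfolding bilinear_def by (intro conjI allI linear_compose_sum) (use b bilinear_def in blast)+
  with b show ?thesis unfolding homogeneous_quadratic_def
    by (intro exI[of _ "\<lambda>x y. \<Sum>i\<in>F. b i x y"]) (auto intro: sum.cong)
qed

text \<open>Splitting off one variable; once or twice applied, it exhibits monomials of degree one
  or two as products of coordinates.\<close>

lemma multi_index_Suc:
  assumes "sum \<alpha> (UNIV :: 'm::finite set) = Suc k"
  obtains j \<beta> where "sum \<beta> UNIV = k" "\<And>x. monomial_at x \<alpha> = x $ j * monomial_at x \<beta>"
proof -
  from assms obtain j where j: "\<alpha> j \<noteq> 0" by fastforce
  define \<beta> where "\<beta> = \<alpha>(j := \<alpha> j - 1)"
  have "sum \<alpha> UNIV = \<alpha> j + sum \<alpha> (UNIV - {j})" by (simp add: sum.remove)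
  moreover have "sum \<beta> UNIV = \<beta> j + sum \<beta> (UNIV - {j})" by (simp add: sum.remove)
  moreover have "sum \<beta> (UNIV - {j}) = sum \<alpha> (UNIV - {j})" by (rule sum.cong) (auto simp: \<beta>_def)
  ultimately have 1: "sum \<beta> UNIV = k" using assms j by (simp add: \<beta>_def)
  have "monomial_at x \<alpha> = x $ j * monomial_at x \<beta>" for x :: "real^'m"
  proof -
    have "monomial_at x \<alpha> = x $ j ^ \<alpha> j * (\<Prod>i\<in>UNIV-{j}. x $ i ^ \<alpha> i)"
      by (simp add: monomial_at_def prod.remove)
    moreover have "monomial_at x \<beta> = x $ j ^ \<beta> j * (\<Prod>i\<in>UNIV-{j}. x $ i ^ \<beta> i)"
      by (simp add: monomial_at_def prod.remove)
    moreover have "(\<Prod>i\<in>UNIV-{j}. x $ i ^ \<beta> i) = (\<Prod>i\<in>UNIV-{j}. x $ i ^ \<alpha> i)"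
      by (rule prod.cong) (auto simp: \<beta>_def)
    moreover have "x $ j ^ \<alpha> j = x $ j * x $ j ^ \<beta> j"
      using j by (simp add: \<beta>_def flip: power_Suc)
    ultimately show ?thesis by simp
  qed
  with 1 show ?thesis by (rule that)
qed

lemma multi_index_0: "sum \<alpha> (UNIV :: 'm::finite set) = 0 \<Longrightarrow> monomial_at x \<alpha> = 1"
  by (simp add: monomial_at_def)

lemma linear_homogeneous_part: "linear (homogeneous_part c 1)"
  unfolding homogeneous_part_def
proof (rule linear_compose_sum, safe)
  fix \<alpha> :: "'a \<Rightarrow> nat" assume "sum \<alpha> UNIV = 1"
  then obtain j \<beta> where "sum \<beta> UNIV = 0" "\<And>x. monomial_at x \<alpha> = x $ j * monomial_at x \<beta>"
    by (metis One_nat_def multi_index_Suc)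
  then have "\<And>x. monomial_at x \<alpha> = x $ j" by (simp add: multi_index_0)
  then show "linear (\<lambda>x. monomial_at x \<alpha> *\<^sub>R c \<alpha>)" by (auto intro!: linearI simp: scaleR_add_left)
qed

lemma quadratic_homogeneous_part: "homogeneous_quadratic (homogeneous_part c 2)"
  unfolding homogeneous_part_def
proof (rule homogeneous_quadratic_sum, safe)
  fix \<alpha> :: "'a \<Rightarrow> nat" assume "sum \<alpha> UNIV = 2"
  then obtain j \<beta> where "sum \<beta> UNIV = 1" "\<And>x. monomial_at x \<alpha> = x $ j * monomial_at x \<beta>"
    by (metis Suc_1 multi_index_Suc)
  moreover then obtain l \<gamma> where "sum \<gamma> UNIV = 0" "\<And>x. monomial_at x \<beta> = x $ l * monomial_at x \<gamma>"
    by (metis One_nat_def multi_index_Suc)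
  ultimately have eq: "\<And>x. monomial_at x \<alpha> = x $ j * x $ l" by (simp add: multi_index_0)
  have "bilinear (\<lambda>x y. (x $ j * y $ l) *\<^sub>R c \<alpha>)"
    unfolding bilinear_def by (auto intro!: linearI simp: algebra_simps)
  then show "homogeneous_quadratic (\<lambda>x. monomial_at x \<alpha> *\<^sub>R c \<alpha>)"
    unfolding homogeneous_quadratic_def by (intro exI[of _ "\<lambda>x y. (x $ j * y $ l) *\<^sub>R c \<alpha>"]) (auto simp: eq)
qed

text \<open>Each monomial becomes a product of affine functions of \<open>s\<close>. Being a
  polynomial in \<open>s\<close>, the restriction can later be evaluated at complex points.\<close>

lemma homogeneous_part_on_line:
  "\<exists>P. \<forall>s. poly P s = homogeneous_part c k (s *\<^sub>R e + y) $ i"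
proof -
  let ?P = "\<Sum>\<alpha> | sum \<alpha> UNIV = k. (\<Prod>j\<in>UNIV. [:y $ j, e $ j:] ^ \<alpha> j) * [:c \<alpha> $ i:]"
  have "poly ?P s = homogeneous_part c k (s *\<^sub>R e + y) $ i" for s
    by (simp add: homogeneous_part_def monomial_at_def poly_sum poly_prod algebra_simps)
  then show ?thesis by blast
qed

section \<open>Derivative and 2-jet from remainder bounds\<close>

lemma has_derivative_of_quadratic_remainder:
  fixes f :: "'a::euclidean_space \<Rightarrow> 'b::real_normed_vector"
  assumes "linear A" "f 0 = 0" "\<rho> > 0"
    and "\<And>x. norm x \<le> \<rho> \<Longrightarrow> norm (f x - A x) \<le> K * (norm x)\<^sup>2"
  shows "(f has_derivative A) (at 0)"
  unfolding has_derivative_at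
proof (intro conjI)
  show "bounded_linear A" using assms(1) by (simp add: linear_conv_bounded_linear)
  have "((\<lambda>h::'a. K * norm h) \<longlongrightarrow> 0) (at 0)"
    by (auto intro!: tendsto_eq_intros)
  moreover have "\<forall>\<^sub>F h in at 0. norm (norm (f (0 + h) - f 0 - A h) / norm h) \<le> K * norm h"
    unfolding eventually_at
  proof (intro exI[of _ \<rho>] conjI ballI impI)
    fix h :: 'a assume "h \<noteq> 0 \<and> dist h 0 < \<rho>"
    then show "norm (norm (f (0 + h) - f 0 - A h) / norm h) \<le> K * norm h"
      using assms(4)[of h] assms(2) by (simp add: divide_le_eq power2_eq_square mult.assoc)
  qed (fact assms)
  ultimately show "(\<lambda>h. norm (f (0 + h) - f 0 - A h) / norm h) \<midarrow>0\<rightarrow> 0"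
    by (rule Lim_null_comparison[rotated])
qed

lemma has_2jet_of_cubic_remainder:
  assumes "linear A" "homogeneous_quadratic B" "\<Phi> 0 = 0" "\<rho> > 0"
    and "\<And>x. norm x \<le> \<rho> \<Longrightarrow> norm (\<Phi> x - (A x + B x)) \<le> K * norm x ^ 3"
  shows "has_2jet \<Phi> A B"
  unfolding has_2jet_def
proof (intro conjI)
  have "((\<lambda>h::real^'a. K * norm h) \<longlongrightarrow> 0) (at 0)"
    by (auto intro!: tendsto_eq_intros)
  moreover have "\<forall>\<^sub>F x in at 0. norm ((\<Phi> x - A x - B x) /\<^sub>R (norm x)\<^sup>2) \<le> K * norm x"
    unfolding eventually_at
  proof (intro exI[of _ \<rho>] conjI ballI impI)
    fix h :: "real^'a" assume "h \<noteq> 0 \<and> dist h 0 < \<rho>"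
    then have h: "h \<noteq> 0" "norm h \<le> \<rho>" by auto
    have "norm ((\<Phi> h - A h - B h) /\<^sub>R (norm h)\<^sup>2) = norm (\<Phi> h - (A h + B h)) / (norm h)\<^sup>2"
      by (simp add: diff_diff_eq divide_inverse mult.commute)
    also have "\<dots> \<le> K * norm h"
      using assms(5)[OF h(2)] h(1)
      by (simp add: divide_le_eq power2_eq_square power3_eq_cube mult.assoc)
    finally show "norm ((\<Phi> h - A h - B h) /\<^sub>R (norm h)\<^sup>2) \<le> K * norm h" .
  qed (fact assms)
  ultimately show "((\<lambda>x. (\<Phi> x - A x - B x) /\<^sub>R (norm x)\<^sup>2) \<longlongrightarrow> 0) (at 0)"
    by (rule Lim_null_comparison[rotated])
qed (use assms in auto)

subsection \<open>Curves on circles\<close>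

text \<open>Justifies comparison of coefficients up to an error \<open>O(t ^ n)\<close>: the
  constant term is the limit at 0, hence zero, and a factor \<open>t\<close> can then be cancelled
  on a punctured neighbourhood.\<close>

lemma coeff_eq_0_if_poly_bigo:
  fixes p :: "real poly"
  assumes "poly p \<in> O[at 0](\<lambda>t. t ^ n)" "k < n"
  shows "coeff p k = 0"
  using assms
proof (induction n arbitrary: p k)
  case (Suc n)
  obtain a q where p: "p = pCons a q" by (rule pCons_cases)
  have "(\<lambda>t::real. t ^ Suc n) \<in> o[at 0](\<lambda>_. 1 :: real)"
    by (rule smalloI_tendsto) (auto intro!: tendsto_eq_intros)
  then have "poly p \<in> o[at 0](\<lambda>_. 1)"
    using Suc.prems(1) by (rule landau_o.big_small_trans[rotated])
  then have "(poly p \<longlongrightarrow> 0) (at 0)" using smalloD_tendsto by fastforce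
  moreover have "(poly p \<longlongrightarrow> poly p 0) (at 0)"
    using poly_isCont[where p=p and x=0] by (simp add: isCont_def)
  ultimately have "poly p 0 = 0" by (rule LIM_unique[symmetric])
  then have a: "a = 0" by (simp add: p)
  have "(\<lambda>t. t * poly q t) \<in> O[at 0](\<lambda>t. t * t ^ n)"
    using Suc.prems(1) by (simp add: p a)
  then have "poly q \<in> O[at 0](\<lambda>t. t ^ n)"
    by (subst (asm) landau_o.big.mult_cancel_left) (auto simp: eventually_at intro!: exI[of _ 1])
  from Suc.IH[OF this] have "coeff q j = 0" if "j < n" for j using that .
  with Suc.prems(2) show ?case by (simp add: p a coeff_pCons split: nat.split)
qed (simp only: not_less0)

text \<open>If a sphere with centre \<open>w\<close> passes through the origin, its radius is
  \<open>norm w\<close>, so its equation loses the constant term and becomes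
  \<open>y \<bullet> y = 2 * (w \<bullet> y)\<close>; affine sets through the origin are
  subspaces.\<close>

lemma is_circle_through_0_cases:
  fixes C :: "'a::euclidean_space set"
  assumes "is_circle C" "0 \<in> C"
  obtains "C = {0}" | "subspace C" "dim C = 1"
  | P w where "subspace P" "dim P = 2" "w \<in> P" "C = {y \<in> P. y \<bullet> y = 2 * (w \<bullet> y)}"
proof -
  consider (1) P c r where "affine P" "aff_dim P = 2" "c \<in> P" "r > 0" "C = sphere c r \<inter> P"
    | (2) "affine C" "aff_dim C = 1" | (3) a where "C = {a}"
    using assms(1) unfolding is_circle_def by blast
  then show thesis
  proof cases
    case 1
    have P: "subspace P" using 1 assms(2) subspace_affine by auto
    moreover have "dim P = 2" using aff_dim_subspace[OF P] 1(2) by simp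
    moreover have "C = {y \<in> P. y \<bullet> y = 2 * (c \<bullet> y)}"
    proof -
      have r: "r = norm c" using assms(2) 1(5) by (simp add: dist_norm)
      have "dist c y = r \<longleftrightarrow> y \<bullet> y = 2 * (c \<bullet> y)" for y
      proof -
        have "dist c y = r \<longleftrightarrow> (c - y) \<bullet> (c - y) = c \<bullet> c"
          by (simp add: r dist_norm norm_eq_sqrt_inner)
        then show ?thesis by (auto simp: inner_diff inner_commute)
      qed
      then show ?thesis unfolding 1(5) sphere_def by blast
    qed
    ultimately show ?thesis using 1(3) that(3) by blast
  next
    case 2
    then have "subspace C" using assms(2) subspace_affine by auto
    then show ?thesis using 2(2) aff_dim_subspace[of C] that(2) by simp
  next
    case 3
    then show ?thesis using assms(2) that(1) by simp
  qed
qed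

lemma subspace_mem_if_orthogonal:
  fixes P :: "'a::euclidean_space set"
  assumes "subspace P" "\<And>z. (\<And>p. p \<in> P \<Longrightarrow> z \<bullet> p = 0) \<Longrightarrow> z \<bullet> a = 0"
  shows "a \<in> P"
proof -
  obtain u z where u: "u \<in> span P" and z: "\<And>p. p \<in> span P \<Longrightarrow> orthogonal z p" and a: "a = u + z"
    using orthogonal_subspace_decomp_exists by metis
  have "z \<bullet> p = 0" if "p \<in> P" for p using z[of p] that span_base by (auto simp: orthogonal_def)
  then have "z \<bullet> a = 0" by (rule assms(2))
  moreover have "z \<bullet> u = 0" using z[OF u] by (simp add: orthogonal_def)
  ultimately have "z = 0" by (simp add: a inner_add_right)
  then show ?thesis using u a assms(1) by (simp add: span_eq_iff[THEN iffD2])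
qed

lemma bigo_inner_const:
  fixes f :: "real \<Rightarrow> 'a::real_inner"
  assumes "(\<lambda>t. norm (f t)) \<in> O[at 0](g)"
  shows "(\<lambda>t. z \<bullet> f t) \<in> O[at 0](g)"
proof (rule landau_o.big_trans[OF _ assms])
  show "(\<lambda>t. z \<bullet> f t) \<in> O[at 0](\<lambda>t. norm (f t))"
    by (rule bigoI[of _ "norm z"]) (simp add: Cauchy_Schwarz_ineq2)
qed

lemma two_dim_subspace_combination:
  fixes P :: "'a::euclidean_space set"
  assumes "subspace P" "dim P = 2" "a \<in> P" "b \<in> P" "a \<noteq> 0" "\<And>k. b \<noteq> k *\<^sub>R a" "v \<in> P"
  obtains k l where "v = k *\<^sub>R a + l *\<^sub>R b"
proof -
  have "b \<notin> span {a}" using assms(6) by (auto simp: span_singleton)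
  then have "independent {b, a}" using assms(5) by (simp add: independent_insert)
  moreover have "card {b, a} = 2" using assms(6)[of 1] by auto
  ultimately have "P \<subseteq> span {b, a}"
    using assms(2,3,4) by (intro card_ge_dim_independent) auto
  then have "v \<in> span {b, a}" using assms(7) by blast
  then show ?thesis
    using that by (auto simp: span_insert span_singleton algebra_simps) (metis add.commute diff_add_cancel)
qed

lemma one_dim_subspace_multiple:
  fixes P :: "'a::euclidean_space set"
  assumes "subspace P" "dim P = 1" "a \<in> P" "a \<noteq> 0" "v \<in> P"
  obtains k where "v = k *\<^sub>R a"
proof -
  have "P \<subseteq> span {a}"
    using assms by (intro card_ge_dim_independent) auto
  then show ?thesis using that assms(5) by (auto simp: span_singleton)
qed

text \<open>Models \<open>t \<mapsto> \<Phi> (t *\<^sub>R x)\<close>. The expansion goes to order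
  four because the coefficient of \<open>t ^ 4\<close> in the circle equation is the first to
  contain \<open>b \<bullet> b\<close>. The nonzero velocity excludes the one-point circle.\<close>

locale curve_on_circle =
  fixes \<phi> :: "real \<Rightarrow> 'a::euclidean_space" and a b c d :: 'a and C :: "'a set"
  assumes circle: "is_circle C" and on_circle: "\<forall>\<^sub>F t in nhds 0. \<phi> t \<in> C" and start: "\<phi> 0 = 0"
    and velocity: "a \<noteq> 0"
    and jet: "(\<lambda>t. norm (\<phi> t - (t *\<^sub>R a + t\<^sup>2 *\<^sub>R b + t ^ 3 *\<^sub>R c + t ^ 4 *\<^sub>R d))) \<in> O[at 0](\<lambda>t. t ^ 5)"
begin

lemma zero_mem: "0 \<in> C"
  using eventually_nhds_x_imp_x[OF on_circle] start by simp

lemma on_circle_at: "\<forall>\<^sub>F t in at 0. \<phi> t \<in> C"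
  using on_circle by (simp add: eventually_nhds_conv_at)

lemma inner_jet:
  "(\<lambda>t. z \<bullet> \<phi> t - poly [:0, z \<bullet> a, z \<bullet> b, z \<bullet> c, z \<bullet> d:] t) \<in> O[at 0](\<lambda>t. t ^ 5)"
proof -
  have "z \<bullet> \<phi> t - poly [:0, z \<bullet> a, z \<bullet> b, z \<bullet> c, z \<bullet> d:] t
    = z \<bullet> (\<phi> t - (t *\<^sub>R a + t\<^sup>2 *\<^sub>R b + t ^ 3 *\<^sub>R c + t ^ 4 *\<^sub>R d))" for t
    by (simp add: inner_diff_right inner_add_right algebra_simps power2_eq_square power3_eq_cube power4_eq_xxxx)
  then show ?thesis using bigo_inner_const[OF jet, of z] by simp
qed

text \<open>A vector \<open>z\<close> orthogonal to \<open>P\<close> annihilates the curve near 0,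
  hence every coefficient of the expansion of \<open>z \<bullet> \<phi> t\<close>.\<close>

lemma jet_in_subspace:
  assumes "subspace P" "C \<subseteq> P"
  shows "a \<in> P" "b \<in> P" "c \<in> P" "d \<in> P"
proof -
  have "z \<bullet> a = 0 \<and> z \<bullet> b = 0 \<and> z \<bullet> c = 0 \<and> z \<bullet> d = 0" if z: "\<And>p. p \<in> P \<Longrightarrow> z \<bullet> p = 0" for z
  proof -
    let ?p = "[:0, z \<bullet> a, z \<bullet> b, z \<bullet> c, z \<bullet> d:]"
    have ev: "\<forall>\<^sub>F t in at 0. z \<bullet> \<phi> t - poly ?p t = - poly ?p t"
      using on_circle_at by eventually_elim (use assms(2) z in auto)
    have "(\<lambda>t. - poly ?p t) \<in> O[at 0](\<lambda>t. t ^ 5)"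
      using inner_jet[of z] landau_o.big.in_cong[OF ev] by blast
    then have "poly ?p \<in> O[at 0](\<lambda>t. t ^ 5)" by (subst (asm) landau_o.big.uminus_in_iff)
    from coeff_eq_0_if_poly_bigo[OF this, of 1] coeff_eq_0_if_poly_bigo[OF this, of 2]
      coeff_eq_0_if_poly_bigo[OF this, of 3] coeff_eq_0_if_poly_bigo[OF this, of 4]
    show ?thesis by (simp add: numeral_eq_Suc)
  qed
  then show "a \<in> P" "b \<in> P" "c \<in> P" "d \<in> P"
    using subspace_mem_if_orthogonal[OF assms(1)] by metis+
qed

lemma norm_jet:
  "(\<lambda>t. \<phi> t \<bullet> \<phi> t - poly [:0, 0, a \<bullet> a, 2 * (a \<bullet> b), b \<bullet> b + 2 * (a \<bullet> c):] t) \<in> O[at 0](\<lambda>t. t ^ 5)"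
proof -
  define T where "T = (\<lambda>t. t *\<^sub>R a + t\<^sup>2 *\<^sub>R b + t ^ 3 *\<^sub>R c + t ^ 4 *\<^sub>R d)"
  define E where "E = (\<lambda>t. \<phi> t - T t)"
  have E: "(\<lambda>t. norm (E t)) \<in> O[at 0](\<lambda>t. t ^ 5)" using jet by (simp add: E_def T_def)
  have one: "(\<lambda>t::real. t ^ 5) \<in> O[at 0](\<lambda>_. 1)"
    by (rule landau_o.small_imp_big, rule smalloI_tendsto) (auto intro!: tendsto_eq_intros)
  have "(T \<longlongrightarrow> 0) (at 0)" unfolding T_def by (auto intro!: tendsto_eq_intros)
  then have T1: "(\<lambda>t. norm (T t)) \<in> O[at 0](\<lambda>_. 1)"
    by (intro landau_o.small_imp_big smalloI_tendsto) (auto intro!: tendsto_norm_zero)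
  have "(\<lambda>t. 2 * (norm (T t) * norm (E t)) + norm (E t) * norm (E t)) \<in> O[at 0](\<lambda>t. t ^ 5)"
    using landau_o.big.mult[OF T1 E] landau_o.big.mult[OF landau_o.big_trans[OF E one] E]
    by (intro sum_in_bigo) auto
  then have "(\<lambda>t. 2 * (T t \<bullet> E t) + E t \<bullet> E t) \<in> O[at 0](\<lambda>t. t ^ 5)"
  proof (rule landau_o.big_trans[rotated])
    show "(\<lambda>t. 2 * (T t \<bullet> E t) + E t \<bullet> E t)
        \<in> O[at 0](\<lambda>t. 2 * (norm (T t) * norm (E t)) + norm (E t) * norm (E t))"
    proof (rule bigoI[of _ 1], rule always_eventually, rule allI)
      fix t
      show "norm (2 * (T t \<bullet> E t) + E t \<bullet> E t)
        \<le> 1 * norm (2 * (norm (T t) * norm (E t)) + norm (E t) * norm (E t))"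
        (is "_ \<le> 1 * norm ?R")
      proof -
        have "E t \<bullet> E t = norm (E t) * norm (E t)" by (simp add: dot_square_norm power2_eq_square)
        moreover have "\<bar>T t \<bullet> E t\<bar> \<le> norm (T t) * norm (E t)" by (rule Cauchy_Schwarz_ineq2)
        moreover have "0 \<le> norm (E t) * norm (E t)" by simp
        ultimately have "\<bar>2 * (T t \<bullet> E t) + E t \<bullet> E t\<bar> \<le> ?R" by linarith
        then show ?thesis by (simp only: real_norm_def mult_1_left)
      qed
    qed
  qed
  \<comment> \<open>The polynomial \<open>?r\<close> collects the coefficients of
    \<open>t ^ 5\<close> to \<open>t ^ 8\<close> in \<open>T t \<bullet> T t\<close>.\<close>
  moreover have "(\<lambda>t. t ^ 5 * poly [:2 * (a \<bullet> d) + 2 * (b \<bullet> c), 2 * (b \<bullet> d) + c \<bullet> c, 2 * (c \<bullet> d), d \<bullet> d:] t)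
      \<in> O[at 0](\<lambda>t. t ^ 5)" (is "(\<lambda>t. t ^ 5 * poly ?r t) \<in> _")
  proof -
    have "poly ?r \<in> O[at 0](\<lambda>_. 1)"
      by (rule bigoI_tendsto[of _ _ "poly ?r 0"]) (use poly_isCont[where p="?r" and x=0] in \<open>auto simp: isCont_def\<close>)
    from landau_o.big.mult[OF landau_o.big_refl this, of "\<lambda>t. t ^ 5"] show ?thesis by simp
  qed
  ultimately have "(\<lambda>t. (2 * (T t \<bullet> E t) + E t \<bullet> E t) + t ^ 5 * poly ?r t) \<in> O[at 0](\<lambda>t. t ^ 5)"
    by (rule sum_in_bigo)
  moreover have "(2 * (T t \<bullet> E t) + E t \<bullet> E t) + t ^ 5 * poly ?r t
     = \<phi> t \<bullet> \<phi> t - poly [:0, 0, a \<bullet> a, 2 * (a \<bullet> b), b \<bullet> b + 2 * (a \<bullet> c):] t" for t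
  proof -
    have "\<phi> t = T t + E t" by (simp add: E_def)
    then have "\<phi> t \<bullet> \<phi> t = T t \<bullet> T t + 2 * (T t \<bullet> E t) + E t \<bullet> E t"
      by (simp add: inner_add inner_commute)
    moreover have "T t \<bullet> T t = poly [:0, 0, a \<bullet> a, 2 * (a \<bullet> b), b \<bullet> b + 2 * (a \<bullet> c):] t + t ^ 5 * poly ?r t"
      unfolding T_def
      by (simp add: inner_add_left inner_add_right inner_commute algebra_simps numeral_eq_Suc)
    ultimately show ?thesis by simp
  qed
  ultimately show ?thesis by simp
qed

text \<open>These are the coefficients of \<open>t\<close> to \<open>t ^ 4\<close> in the identity
  \<open>\<phi> t \<bullet> \<phi> t = 2 * (w \<bullet> \<phi> t)\<close>.\<close>

lemma circle_equations:
  assumes "C \<subseteq> {y. y \<bullet> y = 2 * (w \<bullet> y)}"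
  shows "w \<bullet> a = 0" "a \<bullet> a = 2 * (w \<bullet> b)" "a \<bullet> b = w \<bullet> c" "b \<bullet> b + 2 * (a \<bullet> c) = 2 * (w \<bullet> d)"
proof -
  let ?p = "[:0, 0, a \<bullet> a, 2 * (a \<bullet> b), b \<bullet> b + 2 * (a \<bullet> c):]
    - smult 2 [:0, w \<bullet> a, w \<bullet> b, w \<bullet> c, w \<bullet> d:]"
  have "(\<lambda>t. 2 * (w \<bullet> \<phi> t - poly [:0, w \<bullet> a, w \<bullet> b, w \<bullet> c, w \<bullet> d:] t)) \<in> O[at 0](\<lambda>t. t ^ 5)"
    using inner_jet[of w] by (subst landau_o.big.cmult_in_iff) auto
  from sum_in_bigo(2)[OF this norm_jet]
  have "(\<lambda>t. 2 * (w \<bullet> \<phi> t - poly [:0, w \<bullet> a, w \<bullet> b, w \<bullet> c, w \<bullet> d:] t)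
    - (\<phi> t \<bullet> \<phi> t - poly [:0, 0, a \<bullet> a, 2 * (a \<bullet> b), b \<bullet> b + 2 * (a \<bullet> c):] t)) \<in> O[at 0](\<lambda>t. t ^ 5)"
    (is "?f \<in> _") .
  moreover have ev: "\<forall>\<^sub>F t in at 0. ?f t = poly ?p t"
    using on_circle_at
  proof eventually_elim
    case (elim t)
    with assms have "\<phi> t \<bullet> \<phi> t = 2 * (w \<bullet> \<phi> t)" by auto
    then show ?case by (simp add: algebra_simps)
  qed
  ultimately have "poly ?p \<in> O[at 0](\<lambda>t. t ^ 5)"
    using landau_o.big.in_cong[OF ev] by blast
  from coeff_eq_0_if_poly_bigo[OF this, of 1] coeff_eq_0_if_poly_bigo[OF this, of 2]
    coeff_eq_0_if_poly_bigo[OF this, of 3] coeff_eq_0_if_poly_bigo[OF this, of 4]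
  show "w \<bullet> a = 0" "a \<bullet> a = 2 * (w \<bullet> b)" "a \<bullet> b = w \<bullet> c" "b \<bullet> b + 2 * (a \<bullet> c) = 2 * (w \<bullet> d)"
    by (simp_all add: numeral_eq_Suc)
qed

lemma not_singleton: "C \<noteq> {0}"
  using jet_in_subspace(1)[of "{0}"] velocity by auto

text \<open>On a round circle \<open>a\<close> and \<open>b\<close> span the plane, so
  \<open>c\<close> and \<open>d\<close> are combinations of them. Pairing with the centre
  \<open>w\<close>, which is orthogonal to \<open>a\<close> and has
  \<open>2 * (w \<bullet> b) = a \<bullet> a\<close>, computes the coefficients of
  \<open>b\<close>.\<close>

lemma jet_relations:
  "\<exists>\<alpha> \<beta> \<gamma> \<delta>. c = \<alpha> *\<^sub>R a + \<beta> *\<^sub>R b \<and> d = \<gamma> *\<^sub>R a + \<delta> *\<^sub>R b \<and>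
     2 * (a \<bullet> b) = \<beta> * (a \<bullet> a) \<and> b \<bullet> b + 2 * (a \<bullet> c) = \<delta> * (a \<bullet> a)"
  using is_circle_through_0_cases[OF circle zero_mem]
proof cases
  case 1
  with not_singleton show ?thesis by simp
next
  case 2
  note mem = jet_in_subspace[OF 2(1) subset_refl]
  obtain k l m where k: "b = k *\<^sub>R a" "c = l *\<^sub>R a" "d = m *\<^sub>R a"
    using one_dim_subspace_multiple[OF 2 mem(1) velocity] mem by metis
  \<comment> \<open>On a line \<open>a\<close> and \<open>b\<close> are dependent, which leaves
    freedom in the combinations. The two scalar equations dictate \<open>\<beta> = 2 * k\<close> and
    \<open>\<delta> = k * k + 2 * l\<close>; \<open>\<alpha>\<close> and \<open>\<gamma>\<close>
    absorb the difference.\<close>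
  show ?thesis
    by (intro exI[of _ "l - 2 * k * k"] exI[of _ "2 * k"] exI[of _ "m - (k * k + 2 * l) * k"] exI[of _ "k * k + 2 * l"])
      (simp add: k algebra_simps)
next
  case (3 P w)
  have "C \<subseteq> P" using 3 by auto
  note mem = jet_in_subspace[OF 3(1) this]
  have "C \<subseteq> {y. y \<bullet> y = 2 * (w \<bullet> y)}" using 3 by auto
  note eqs = circle_equations[OF this]
  \<comment> \<open>Otherwise \<open>w \<bullet> b = 0\<close>, and then
    \<open>a \<bullet> a = 0\<close>.\<close>
  have "b \<noteq> k *\<^sub>R a" for k using eqs(1,2) velocity by auto
  note comb = two_dim_subspace_combination[OF 3(1,2) mem(1,2) velocity this]
  obtain \<alpha> \<beta> where c: "c = \<alpha> *\<^sub>R a + \<beta> *\<^sub>R b" using comb[OF mem(3)] .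
  obtain \<gamma> \<delta> where d: "d = \<gamma> *\<^sub>R a + \<delta> *\<^sub>R b" using comb[OF mem(4)] .
  have "2 * (a \<bullet> b) = \<beta> * (a \<bullet> a)" using eqs(1,2,3) c by (simp add: inner_add_right)
  moreover have "b \<bullet> b + 2 * (a \<bullet> c) = \<delta> * (a \<bullet> a)"
    using eqs(1,2,4) d by (simp add: inner_add_right)
  ultimately show ?thesis using c d by blast
qed

text \<open>As \<open>w\<close> is orthogonal to \<open>a\<close>, replacing \<open>b\<close> by
  \<open>b'\<close> does not change its pairing with \<open>w\<close>. For
  \<open>u = t *\<^sub>R a + t\<^sup>2 *\<^sub>R b'\<close> one gets
  \<open>2 * (w \<bullet> u) = t\<^sup>2 * (a \<bullet> a)\<close>, while
  \<open>u \<bullet> u\<close> is this times \<open>1 + t\<^sup>2 * q\<close>; dividing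
  \<open>u\<close> by that factor puts it on the circle.\<close>

lemma rational_point_mem:
  assumes b': "b' = b - k *\<^sub>R a" and perp: "a \<bullet> b' = 0" and q: "b' \<bullet> b' = q * (a \<bullet> a)" "q \<ge> 0"
  shows "(1 / (1 + t\<^sup>2 * q)) *\<^sub>R (t *\<^sub>R a + t\<^sup>2 *\<^sub>R b') \<in> C" (is "?y \<in> C")
proof -
  have mem: "?y \<in> P" if "subspace P" "C \<subseteq> P" for P
    unfolding b' using jet_in_subspace[OF that] that
    by (intro subspace_mul subspace_add subspace_diff) auto
  show ?thesis
    using is_circle_through_0_cases[OF circle zero_mem]
  proof cases
    case 1
    with not_singleton show ?thesis by simp
  next
    case 2
    with mem show ?thesis by blast
  next
    case (3 P w)
    have "C \<subseteq> {y. y \<bullet> y = 2 * (w \<bullet> y)}" using 3 by auto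
    note eqs = circle_equations[OF this]
    define s where "s = 1 + t\<^sup>2 * q"
    have s: "s > 0" using q by (simp add: s_def add_pos_nonneg)
    have "(t *\<^sub>R a + t\<^sup>2 *\<^sub>R b') \<bullet> (t *\<^sub>R a + t\<^sup>2 *\<^sub>R b') = t\<^sup>2 * (a \<bullet> a) * s"
      using perp q(1) by (simp add: inner_add inner_commute s_def algebra_simps power2_eq_square)
    moreover have "2 * (w \<bullet> (t *\<^sub>R a + t\<^sup>2 *\<^sub>R b')) = t\<^sup>2 * (a \<bullet> a)"
      using eqs(1,2) by (simp add: b' inner_add_right inner_diff_right)
    ultimately have "?y \<bullet> ?y = 2 * (w \<bullet> ?y)"
      using s unfolding s_def[symmetric] inner_scaleR_left inner_scaleR_right by (simp add: field_simps)
    moreover have "?y \<in> P" using mem 3 by blast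
    ultimately show ?thesis using 3(4) by simp
  qed
qed

end

subsection \<open>Divisibility by \<open>\<langle>A, A\<rangle>\<close>\<close>

text \<open>The zeros of \<open>s \<mapsto> A (s *\<^sub>R e + y) \<bullet> A (s *\<^sub>R e +
  y)\<close> that matter are not real, so real polynomial identities are transported to complex
  arguments.\<close>

definition complex_poly :: "real poly \<Rightarrow> complex \<Rightarrow> complex" where
  "complex_poly p z = poly (map_poly complex_of_real p) z"

lemma complex_poly_0 [simp]: "complex_poly 0 z = 0"
  by (simp add: complex_poly_def)

lemma complex_poly_pCons [simp]: "complex_poly (pCons a p) z = of_real a + z * complex_poly p z"
  by (simp add: complex_poly_def map_poly_pCons)

lemma complex_poly_add [simp]: "complex_poly (p + q) z = complex_poly p z + complex_poly q z"
  by (induction p q rule: poly_induct2) (simp_all add: algebra_simps)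

lemma complex_poly_smult [simp]: "complex_poly (smult a p) z = of_real a * complex_poly p z"
  by (induction p) (simp_all add: algebra_simps)

lemma complex_poly_diff [simp]: "complex_poly (p - q) z = complex_poly p z - complex_poly q z"
  by (metis add_diff_cancel_right' complex_poly_add diff_add_cancel)

lemma complex_poly_mult [simp]: "complex_poly (p * q) z = complex_poly p z * complex_poly q z"
  by (induction p) (simp_all add: algebra_simps)

lemma complex_poly_sum [simp]: "complex_poly (sum f S) z = (\<Sum>i\<in>S. complex_poly (f i) z)"
  by (induction S rule: infinite_finite_induct) simp_all

lemma real_poly_eqI: "(\<And>s::real. poly p s = poly q s) \<Longrightarrow> p = q"
  using poly_eq_poly_eq_iff[of p q] by blast

lemma real_coeffs_eq_0_if_nonreal_root:
  assumes "of_real r1 * z + of_real r0 = 0" "Im z \<noteq> 0"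
  shows "r1 = 0" "r0 = 0"
proof -
  from arg_cong[OF assms(1), of Im] assms(2) show "r1 = 0" by simp
  with assms(1) show "r0 = 0" by simp
qed

lemma parallel_if_cross_eq_0:
  fixes A X :: "'n \<Rightarrow> complex"
  assumes "A k \<noteq> 0" "\<And>i j. X i * A j - X j * A i = 0"
  shows "X i = (X k / A k) * A i"
  using assms(1) assms(2)[of i k] by (simp add: field_simps)

text \<open>Vanishing minors make \<open>B\<close> a multiple of \<open>A\<close>. The pairing is
  the complex bilinear one, not the Hermitian one, so a nonzero \<open>A\<close> can be isotropic,
  and all its multiples are then isotropic and orthogonal to it.\<close>

lemma isotropic_orthogonal:
  fixes A B :: "'n::finite \<Rightarrow> complex"
  assumes "A k \<noteq> 0" and iso: "(\<Sum>i\<in>UNIV. A i * A i) = 0"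
    and par: "\<And>i j. B i * A j - B j * A i = 0"
  shows "(\<Sum>i\<in>UNIV. A i * B i) = 0" "(\<Sum>i\<in>UNIV. B i * B i) = 0"
proof -
  define m where "m = B k / A k"
  have B: "B i = m * A i" for i
    unfolding m_def by (rule parallel_if_cross_eq_0[where X=B and A=A, OF assms(1) par])
  have "(\<Sum>i\<in>UNIV. A i * B i) = m * (\<Sum>i\<in>UNIV. A i * A i)"
    by (simp add: B sum_distrib_left mult_ac)
  then show "(\<Sum>i\<in>UNIV. A i * B i) = 0" by (simp add: iso)
  have "(\<Sum>i\<in>UNIV. B i * B i) = m * m * (\<Sum>i\<in>UNIV. A i * A i)"
    by (simp add: B sum_distrib_left mult_ac)
  then show "(\<Sum>i\<in>UNIV. B i * B i) = 0" by (simp add: iso)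
qed

lemma eq_at_0_if_eq_off_0:
  fixes f g :: "real \<Rightarrow> 'b::real_normed_vector"
  assumes "continuous_on UNIV f" "continuous_on UNIV g" "\<And>t. t \<noteq> 0 \<Longrightarrow> f t = g t"
  shows "f 0 = g 0"
proof -
  have f: "(f \<longlongrightarrow> f 0) (at 0)" and g: "(g \<longlongrightarrow> g 0) (at 0)"
    using assms(1,2) by (simp_all add: continuous_on_def)
  have "\<forall>\<^sub>F t in at 0. f t = g t"
    using assms(3) by (auto simp: eventually_at_filter)
  from Lim_transform_eventually[OF f this] g show ?thesis by (rule LIM_unique)
qed

text \<open>\<open>A\<close>, \<open>b\<close>, \<open>C\<close>, \<open>D\<close> carry the
  homogeneous parts of degrees one to four. Normalising \<open>e\<close> makes
  \<open>A (s *\<^sub>R e + y) \<bullet> A (s *\<^sub>R e + y)\<close> monic in \<open>s\<close>;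
  \<open>v\<close> witnesses that the rank is at least two.\<close>

locale circular_jet =
  fixes A :: "real^'m \<Rightarrow> real^'n" and b :: "real^'m \<Rightarrow> real^'m \<Rightarrow> real^'n"
    and C D :: "real^'m \<Rightarrow> real^'n" and e v :: "real^'m"
  assumes linear_A: "linear A" and bilinear_b: "bilinear b" and sym_b: "\<And>x y. b x y = b y x"
    and poly_C: "\<And>x y i. \<exists>P. \<forall>s. poly P s = C (s *\<^sub>R x + y) $ i"
    and poly_D: "\<And>x y i. \<exists>P. \<forall>s. poly P s = D (s *\<^sub>R x + y) $ i"
    and relations: "\<And>x. A x \<noteq> 0 \<Longrightarrow> \<exists>\<alpha> \<beta> \<gamma> \<delta>. C x = \<alpha> *\<^sub>R A x + \<beta> *\<^sub>R b x x \<and>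
       D x = \<gamma> *\<^sub>R A x + \<delta> *\<^sub>R b x x \<and> 2 * (A x \<bullet> b x x) = \<beta> * (A x \<bullet> A x) \<and>
       b x x \<bullet> b x x + 2 * (A x \<bullet> C x) = \<delta> * (A x \<bullet> A x)"
    and unit_e: "A e \<bullet> A e = 1" and rank: "\<And>k. A v \<noteq> k *\<^sub>R A e"
begin

abbreviation B where "B x \<equiv> b x x"

lemma A_line: "A (s *\<^sub>R x + y) = s *\<^sub>R A x + A y"
  using linear_A by (simp add: linear_iff)

lemma B_line: "B (s *\<^sub>R x + y) = s\<^sup>2 *\<^sub>R B x + (2 * s) *\<^sub>R b x y + B y"
proof -
  have "(2 * s) *\<^sub>R b x y = s *\<^sub>R b x y + s *\<^sub>R b x y" by (simp only: mult_2 scaleR_add_left)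
  then show ?thesis
    by (simp only: bilinear_ladd[OF bilinear_b] bilinear_radd[OF bilinear_b] bilinear_lmul[OF bilinear_b]
        bilinear_rmul[OF bilinear_b] sym_b[of y x] scaleR_add_right scaleR_scaleR power2_eq_square add_ac)
qed

lemma linear_b: "linear (b x)"
  using bilinear_b by (simp add: bilinear_def)

text \<open>Taking minors with \<open>A\<close> eliminates \<alpha>, and multiplying by
  \<open>A x \<bullet> A x\<close> eliminates \<beta>. What remains is an identity of polynomials,
  valid at zeros of \<open>A\<close> as well, and so usable at complex points.\<close>

lemma cross_C:
  "(A x \<bullet> A x) * (C x $ i * A x $ j - C x $ j * A x $ i)
     = 2 * (A x \<bullet> B x) * (B x $ i * A x $ j - B x $ j * A x $ i)"
proof (cases "A x = 0")
  case False
  from relations[OF this] obtain \<alpha> \<beta> where 1: "C x = \<alpha> *\<^sub>R A x + \<beta> *\<^sub>R B x"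
    and 2: "2 * (A x \<bullet> B x) = \<beta> * (A x \<bullet> A x)" by blast
  show ?thesis unfolding 2 unfolding 1 by (simp add: algebra_simps)
qed simp

lemma cross_D:
  "(A x \<bullet> A x) * (D x $ i * A x $ j - D x $ j * A x $ i)
     = (B x \<bullet> B x + 2 * (A x \<bullet> C x)) * (B x $ i * A x $ j - B x $ j * A x $ i)"
proof (cases "A x = 0")
  case False
  from relations[OF this] obtain \<gamma> \<delta> where 1: "D x = \<gamma> *\<^sub>R A x + \<delta> *\<^sub>R B x"
    and 2: "B x \<bullet> B x + 2 * (A x \<bullet> C x) = \<delta> * (A x \<bullet> A x)" by blast
  show ?thesis unfolding 2 unfolding 1 by (simp add: algebra_simps)
qed simp

text \<open>
  Dividing the polynomial \<open>s \<mapsto> \<langle>A, B\<rangle>(s e + y)\<close> by the monic \<open>s \<mapsto> \<langle>A, A\<rangle>(s e + y)\<close> gives a quotient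
  whose value at \<open>s = 0\<close> is \<open>p y\<close>; likewise \<open>q y\<close> for \<open>\<langle>B, B\<rangle>\<close>.  In this form \<open>p\<close> is visibly linear
  and \<open>q\<close> visibly quadratic, and only the remainders need to be shown to vanish.
\<close>

definition p :: "real^'m \<Rightarrow> real" where
  "p y = A y \<bullet> B e + 2 * (A e \<bullet> b e y) - 2 * (A e \<bullet> B e) * (A e \<bullet> A y)"

definition q :: "real^'m \<Rightarrow> real" where
  "q y = 4 * (b e y \<bullet> b e y) + 2 * (B e \<bullet> B y)
     - 2 * (A e \<bullet> A y) * (4 * (B e \<bullet> b e y) - 2 * (A e \<bullet> A y) * (B e \<bullet> B e)) - (A y \<bullet> A y) * (B e \<bullet> B e)"

lemma linear_p: "linear p"
  unfolding p_def using linear_A linear_b[of e]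
  by (auto intro!: linearI simp: linear_iff algebra_simps inner_add)

lemma quadratic_q: "homogeneous_quadratic q"
proof -
  let ?c = "\<lambda>x y. 4 * (b e x \<bullet> b e y) + 2 * (B e \<bullet> b x y)
     - 2 * (A e \<bullet> A x) * (4 * (B e \<bullet> b e y) - 2 * (A e \<bullet> A y) * (B e \<bullet> B e)) - (A x \<bullet> A y) * (B e \<bullet> B e)"
  have "bilinear ?c"
    unfolding bilinear_def using linear_A linear_b[of e] bilinear_b
    by (auto intro!: linearI simp: bilinear_def linear_iff algebra_simps inner_add)
  then show ?thesis unfolding homogeneous_quadratic_def q_def by (intro exI[of _ ?c]) auto
qed

text \<open>For the monic quadratic, completing the square leaves the Gram determinant
  \<open>c - a\<^sup>2\<close>, which is positive by independence of \<open>A e\<close> and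
  \<open>A y\<close>.\<close>

lemma nonreal_root:
  assumes indep: "\<And>k. A y \<noteq> k *\<^sub>R A e"
  obtains z where "Im z \<noteq> 0" "z\<^sup>2 + 2 * of_real (A e \<bullet> A y) * z + of_real (A y \<bullet> A y) = 0"
proof -
  define a where "a = A e \<bullet> A y"
  define c where "c = A y \<bullet> A y"
  have "0 < (A y - a *\<^sub>R A e) \<bullet> (A y - a *\<^sub>R A e)" using indep[of a] by simp
  also have "\<dots> = c - a\<^sup>2"
    by (simp add: inner_diff unit_e a_def c_def inner_commute power2_eq_square)
  finally have pos: "c - a\<^sup>2 > 0" .
  let ?z = "Complex (- a) (sqrt (c - a\<^sup>2))"
  show thesis
  proof (rule that[of ?z])
    show "Im ?z \<noteq> 0" using pos by simp
    show "?z\<^sup>2 + 2 * of_real (A e \<bullet> A y) * ?z + of_real (A y \<bullet> A y) = 0"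
      unfolding a_def[symmetric] c_def[symmetric] using pos
      by (simp add: complex_eq_iff power2_eq_square algebra_simps)
  qed
qed

end

text \<open>
  For \<open>A y\<close>, \<open>A e\<close> independent, \<open>s \<mapsto> \<langle>A, A\<rangle>(s e + y)\<close> has a nonreal root \<open>z\<close>, and a real remainder of
  degree at most one vanishes once it vanishes at \<open>z\<close>.
\<close>

locale circular_jet_plane = circular_jet A b C D e v
  for A :: "real^'m \<Rightarrow> real^'n" and b C D e v +
  fixes y :: "real^'m" and z :: complex and PC PD :: "'n \<Rightarrow> real poly"
  assumes nonreal: "Im z \<noteq> 0"
    and root: "z\<^sup>2 + 2 * of_real (A e \<bullet> A y) * z + of_real (A y \<bullet> A y) = 0"
    and PC: "\<And>i s. poly (PC i) s = C (s *\<^sub>R e + y) $ i"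
    and PD: "\<And>i s. poly (PD i) s = D (s *\<^sub>R e + y) $ i"
begin

definition PA where "PA i = [:A y $ i, A e $ i:]"
definition PB where "PB i = [:B y $ i, 2 * b e y $ i, B e $ i:]"

lemma PA: "poly (PA i) s = A (s *\<^sub>R e + y) $ i"
  by (simp add: PA_def A_line)

lemma PB: "poly (PB i) s = B (s *\<^sub>R e + y) $ i"
  unfolding B_line by (simp add: PB_def algebra_simps power2_eq_square)

lemmas P_eqs = PA PB PC PD

abbreviation zA where "zA i \<equiv> complex_poly (PA i) z"
abbreviation zB where "zB i \<equiv> complex_poly (PB i) z"
abbreviation zC where "zC i \<equiv> complex_poly (PC i) z"
abbreviation zD where "zD i \<equiv> complex_poly (PD i) z"

text \<open>The imaginary part of \<open>zA k\<close> is \<open>Im z * A e $ k\<close>, and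
  \<open>A e\<close> is nonzero.\<close>

lemma zA_nonzero: "\<exists>k. zA k \<noteq> 0"
proof (rule ccontr)
  assume "\<not> ?thesis"
  then have "Im (zA k) = 0" for k by simp
  then have "A e $ k = 0" for k using nonreal by (simp add: PA_def)
  then have "A e = 0" by (simp add: vec_eq_iff)
  then show False using unit_e by simp
qed

lemma zAA: "(\<Sum>i\<in>UNIV. zA i * zA i) = 0"
proof -
  have "(\<Sum>i\<in>UNIV. PA i * PA i) = [:A y \<bullet> A y, 2 * (A e \<bullet> A y), 1:]"
  proof (rule real_poly_eqI)
    fix s
    have "poly (\<Sum>i\<in>UNIV. PA i * PA i) s = A (s *\<^sub>R e + y) \<bullet> A (s *\<^sub>R e + y)"
      by (simp add: poly_sum PA inner_vec_def)
    also have "\<dots> = poly [:A y \<bullet> A y, 2 * (A e \<bullet> A y), 1:] s"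
      unfolding A_line using unit_e by (simp add: inner_add inner_commute algebra_simps)
    finally show "poly (\<Sum>i\<in>UNIV. PA i * PA i) s = \<dots>" .
  qed
  from arg_cong[OF this, of "\<lambda>P. complex_poly P z"] root
  show ?thesis by (simp add: algebra_simps power2_eq_square)
qed

text \<open>At the root \<open>z\<close> the left side of \<open>cross_C\<close> vanishes. Hence the
  sum is zero, or else all minors of \<open>zA\<close> and \<open>zB\<close> are, and then
  \<open>zB\<close> is a multiple of the isotropic \<open>zA\<close>, which again gives
  zero.\<close>

lemma zAB: "(\<Sum>i\<in>UNIV. zA i * zB i) = 0"
proof -
  have "(\<Sum>k\<in>UNIV. PA k * PA k) * (PC i * PA j - PC j * PA i)
     = smult 2 (\<Sum>k\<in>UNIV. PA k * PB k) * (PB i * PA j - PB j * PA i)" for i j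
    by (rule real_poly_eqI) (use cross_C in \<open>simp add: P_eqs poly_sum inner_vec_def\<close>)
  from arg_cong[OF this, of "\<lambda>P. complex_poly P z"]
  have "(\<Sum>k\<in>UNIV. zA k * zB k) * (zB i * zA j - zB j * zA i) = 0" for i j
    by (simp add: zAA)
  then have "zB i * zA j - zB j * zA i = 0" if "(\<Sum>k\<in>UNIV. zA k * zB k) \<noteq> 0" for i j
    using that by (meson mult_eq_0_iff)
  moreover obtain k where "zA k \<noteq> 0" using zA_nonzero by blast
  ultimately show ?thesis
    using isotropic_orthogonal(1)[where A=zA and B=zB, OF _ zAA] by blast
qed

lemma p_plane: "A y \<bullet> B y = p y * (A y \<bullet> A y)"
proof -
  define f where "f = (A e \<bullet> B e)"
  define g where "g = A y \<bullet> B e + 2 * (A e \<bullet> b e y)"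
  define h where "h = 2 * (A y \<bullet> b e y) + A e \<bullet> B y"
  define a where "a = A e \<bullet> A y"
  define c where "c = A y \<bullet> A y"
  have "(\<Sum>i\<in>UNIV. PA i * PB i) = [:A y \<bullet> B y, h, g, f:]"
  proof (rule real_poly_eqI)
    fix s
    have "poly (\<Sum>i\<in>UNIV. PA i * PB i) s = A (s *\<^sub>R e + y) \<bullet> B (s *\<^sub>R e + y)"
      by (simp add: poly_sum P_eqs inner_vec_def)
    also have "\<dots> = poly [:A y \<bullet> B y, h, g, f:] s"
      unfolding A_line B_line by (simp add: inner_add algebra_simps f_def g_def h_def power2_eq_square)
    finally show "poly (\<Sum>i\<in>UNIV. PA i * PB i) s = \<dots>" .
  qed
  from arg_cong[OF this, of "\<lambda>P. complex_poly P z"] zAB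
  have 0: "complex_poly [:A y \<bullet> B y, h, g, f:] z = 0" by simp
  \<comment> \<open>Long division of the cubic by the monic quadratic: the quotient is
    \<open>f * z + (g - 2 * f * a)\<close>, whose constant term is \<open>p y\<close>, and the left
    side is the remainder.\<close>
  have "of_real (h - f * c - 2 * a * (g - 2 * f * a)) * z + of_real (A y \<bullet> B y - (g - 2 * f * a) * c)
    = complex_poly [:A y \<bullet> B y, h, g, f:] z
      - (z\<^sup>2 + 2 * of_real a * z + of_real c) * (of_real f * z + of_real (g - 2 * f * a))"
    by (simp add: algebra_simps power2_eq_square)
  also have "\<dots> = 0" using root 0 by (simp only: a_def c_def) simp
  finally have "A y \<bullet> B y - (g - 2 * f * a) * c = 0"
    using nonreal real_coeffs_eq_0_if_nonreal_root(2) by blast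
  then show ?thesis by (simp add: p_def f_def g_def a_def c_def)
qed

end

context circular_jet
begin


lemma circular_jet_planeI:
  assumes indep: "\<And>k. A y \<noteq> k *\<^sub>R A e"
  obtains z PC PD where "circular_jet_plane A b C D e v y z PC PD"
proof -
  obtain z where z: "Im z \<noteq> 0" "z\<^sup>2 + 2 * of_real (A e \<bullet> A y) * z + of_real (A y \<bullet> A y) = 0"
    using nonreal_root[OF indep] by metis
  obtain PC where PC: "\<And>i s. poly (PC i) s = C (s *\<^sub>R e + y) $ i" using poly_C by metis
  obtain PD where PD: "\<And>i s. poly (PD i) s = D (s *\<^sub>R e + y) $ i" using poly_D by metis
  have "circular_jet_plane A b C D e v y z PC PD"
    by unfold_locales (use z PC PD in auto)
  then show ?thesis by (rule that)
qed

text \<open>If \<open>A y\<close> is a multiple of \<open>A e\<close>, then by \<open>rank\<close>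
  every point \<open>t *\<^sub>R v + y\<close> with nonzero \<open>t\<close> has an image
  independent of \<open>A e\<close>; let \<open>t\<close> tend to 0.\<close>

lemma eq_if_eq_on_independent:
  fixes f g :: "real^'m \<Rightarrow> real"
  assumes "continuous_on UNIV f" "continuous_on UNIV g"
    and eq: "\<And>y. (\<And>k. A y \<noteq> k *\<^sub>R A e) \<Longrightarrow> f y = g y"
  shows "f y = g y"
proof (cases "\<exists>k. A y = k *\<^sub>R A e")
  case True
  then obtain k where k: "A y = k *\<^sub>R A e" ..
  let ?l = "\<lambda>t. t *\<^sub>R v + y"
  have "f (?l t) = g (?l t)" if "t \<noteq> 0" for t
  proof (rule eq)
    fix m
    show "A (?l t) \<noteq> m *\<^sub>R A e"
    proof
      assume "A (?l t) = m *\<^sub>R A e"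
      then have "t *\<^sub>R A v = (m - k) *\<^sub>R A e" unfolding A_line k by (simp add: algebra_simps)
      then have "A v = ((m - k) / t) *\<^sub>R A e"
        using that by (metis divide_inverse_commute scaleR_one scaleR_scaleR left_inverse)
      then show False using rank by blast
    qed
  qed
  moreover have l: "continuous_on UNIV ?l" by (intro continuous_intros)
  ultimately have "f (?l 0) = g (?l 0)"
    by (intro eq_at_0_if_eq_off_0[where f = "\<lambda>t. f (?l t)" and g = "\<lambda>t. g (?l t)"]
        continuous_on_compose2[OF assms(1) l] continuous_on_compose2[OF assms(2) l]) auto
  then show ?thesis by simp
qed (use eq in blast)

lemma continuous_A: "continuous_on UNIV A"
  using linear_A linear_continuous_on linear_conv_bounded_linear by blast

lemma continuous_b: "continuous_on UNIV f \<Longrightarrow> continuous_on UNIV g \<Longrightarrow> continuous_on UNIV (\<lambda>x. b (f x) (g x))"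
  using bilinear_b bilinear_conv_bounded_bilinear bounded_bilinear.continuous_on by blast

lemma continuous_p: "continuous_on UNIV p"
  using linear_p linear_continuous_on linear_conv_bounded_linear by blast

lemma continuous_q: "continuous_on UNIV q"
  unfolding q_def by (intro continuous_intros continuous_b continuous_A)

theorem A_B_eq: "A y \<bullet> B y = p y * (A y \<bullet> A y)"
proof (rule eq_if_eq_on_independent)
  fix y assume "\<And>k. A y \<noteq> k *\<^sub>R A e"
  then show "A y \<bullet> B y = p y * (A y \<bullet> A y)"
    using circular_jet_planeI circular_jet_plane.p_plane by metis
qed (intro continuous_intros continuous_b continuous_A continuous_p)+

end

context circular_jet_plane
begin

definition PP where "PP = [:p y, p e:]"

lemma PP: "poly PP s = p (s *\<^sub>R e + y)"
  using linear_p by (simp add: PP_def linear_iff algebra_simps)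

text \<open>Sharpens \<open>cross_C\<close>: since \<open>A x \<bullet> B x\<close> is now known to
  be divisible by \<open>A x \<bullet> A x\<close>, that factor cancels, and the identity still
  carries information at \<open>z\<close>.\<close>

lemma cross_C_p:
  "C x $ i * A x $ j - C x $ j * A x $ i = 2 * p x * (B x $ i * A x $ j - B x $ j * A x $ i)"
proof (cases "A x = 0")
  case False
  then show ?thesis using cross_C[of x i j] by (simp add: A_B_eq)
qed simp

text \<open>If \<open>zB\<close> is parallel to \<open>zA\<close>, it is isotropic like
  \<open>zA\<close>. Otherwise \<open>cross_C_p\<close> forces the pairing of \<open>zA\<close> with
  \<open>zC\<close> to vanish, and \<open>cross_D\<close> at \<open>z\<close> then reads: the sum
  times each minor of \<open>zA\<close> and \<open>zB\<close> is zero, where some minor is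
  not.\<close>

lemma zBB: "(\<Sum>i\<in>UNIV. zB i * zB i) = 0"
proof (cases "\<forall>i j. zB i * zA j - zB j * zA i = 0")
  case True
  moreover obtain k where "zA k \<noteq> 0" using zA_nonzero by blast
  ultimately show ?thesis
    using isotropic_orthogonal(2)[where A=zA and B=zB, OF _ zAA] by blast
next
  case False
  obtain k where k: "zA k \<noteq> 0" using zA_nonzero by blast
  \<comment> \<open>Subtracting \<open>2 p B\<close> from \<open>C\<close> makes all minors with
    \<open>A\<close> vanish at \<open>z\<close>, so \<open>X\<close> is a multiple of
    \<open>zA\<close> and thus orthogonal to it.\<close>
  define X where "X i = zC i - 2 * complex_poly PP z * zB i" for i
  have "PC i * PA j - PC j * PA i = smult 2 PP * (PB i * PA j - PB j * PA i)" for i j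
    by (rule real_poly_eqI) (use cross_C_p in \<open>simp add: P_eqs PP\<close>)
  from arg_cong[OF this, of "\<lambda>P. complex_poly P z"]
  have "X i * zA j - X j * zA i = 0" for i j
    by (simp add: X_def algebra_simps)
  then have "(\<Sum>i\<in>UNIV. zA i * X i) = 0"
    using isotropic_orthogonal(1)[where A=zA and B=X, OF k zAA] by blast
  have zAC: "(\<Sum>i\<in>UNIV. zA i * zC i) = 0"
  proof -
    have "(\<Sum>i\<in>UNIV. zA i * X i)
        = (\<Sum>i\<in>UNIV. zA i * zC i) - 2 * complex_poly PP z * (\<Sum>i\<in>UNIV. zA i * zB i)"
      by (simp add: X_def right_diff_distrib sum_subtractf sum_distrib_left mult_ac)
    with \<open>(\<Sum>i\<in>UNIV. zA i * X i) = 0\<close> zAB show ?thesis by simp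
  qed
  have "(\<Sum>k\<in>UNIV. PA k * PA k) * (PD i * PA j - PD j * PA i)
     = ((\<Sum>k\<in>UNIV. PB k * PB k) + smult 2 (\<Sum>k\<in>UNIV. PA k * PC k)) * (PB i * PA j - PB j * PA i)" for i j
    by (rule real_poly_eqI) (use cross_D in \<open>simp add: P_eqs poly_sum inner_vec_def\<close>)
  from arg_cong[OF this, of "\<lambda>P. complex_poly P z"]
  have "(\<Sum>k\<in>UNIV. zB k * zB k) * (zB i * zA j - zB j * zA i) = 0" for i j
    by (simp add: zAA zAC)
  then show ?thesis using False by (meson mult_eq_0_iff)
qed

lemma q_plane: "B y \<bullet> B y = q y * (A y \<bullet> A y)"
proof -
  define f0 where "f0 = B e \<bullet> B e"
  define f1 where "f1 = 4 * (B e \<bullet> b e y)"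
  define f2 where "f2 = 4 * (b e y \<bullet> b e y) + 2 * (B e \<bullet> B y)"
  define f3 where "f3 = 4 * (b e y \<bullet> B y)"
  define a where "a = A e \<bullet> A y"
  define c where "c = A y \<bullet> A y"
  \<comment> \<open>Division of the quartic by the monic quadratic has quotient
    \<open>f0 * z\<^sup>2 + h1 * z + h2\<close>; its constant term \<open>h2\<close> is
    \<open>q y\<close>.\<close>
  define h1 where "h1 = f1 - 2 * a * f0"
  define h2 where "h2 = f2 - 2 * a * h1 - c * f0"
  have "(\<Sum>i\<in>UNIV. PB i * PB i) = [:B y \<bullet> B y, f3, f2, f1, f0:]"
  proof (rule real_poly_eqI)
    fix s
    have "poly (\<Sum>i\<in>UNIV. PB i * PB i) s = B (s *\<^sub>R e + y) \<bullet> B (s *\<^sub>R e + y)"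
      by (simp add: poly_sum P_eqs inner_vec_def)
    also have "\<dots> = poly [:B y \<bullet> B y, f3, f2, f1, f0:] s"
      unfolding B_line by (simp add: inner_add inner_commute algebra_simps f0_def f1_def f2_def f3_def power2_eq_square)
    finally show "poly (\<Sum>i\<in>UNIV. PB i * PB i) s = \<dots>" .
  qed
  from arg_cong[OF this, of "\<lambda>P. complex_poly P z"] zBB
  have 0: "complex_poly [:B y \<bullet> B y, f3, f2, f1, f0:] z = 0" by simp
  have "of_real (f3 - 2 * a * h2 - c * h1) * z + of_real (B y \<bullet> B y - c * h2)
    = complex_poly [:B y \<bullet> B y, f3, f2, f1, f0:] z
      - (z\<^sup>2 + 2 * of_real a * z + of_real c) * (of_real f0 * z\<^sup>2 + of_real h1 * z + of_real h2)"
    by (simp add: h1_def h2_def algebra_simps power2_eq_square)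
  also have "\<dots> = 0" using root 0 by (simp only: a_def c_def) simp
  finally have "B y \<bullet> B y - c * h2 = 0"
    using nonreal real_coeffs_eq_0_if_nonreal_root(2) by blast
  moreover have "h2 = q y"
    by (simp add: q_def h2_def h1_def f0_def f1_def f2_def a_def c_def algebra_simps)
  ultimately show ?thesis by (simp add: c_def)
qed

end

context circular_jet
begin

theorem B_B_eq: "B y \<bullet> B y = q y * (A y \<bullet> A y)"
proof (rule eq_if_eq_on_independent)
  fix y assume "\<And>k. A y \<noteq> k *\<^sub>R A e"
  then show "B y \<bullet> B y = q y * (A y \<bullet> A y)"
    using circular_jet_planeI circular_jet_plane.q_plane by metis
qed (intro continuous_intros continuous_b continuous_A continuous_q)+

end

subsection \<open>Positive definite forms\<close>

text \<open>Gram-Schmidt for \<open>g\<close>. Indexing by subsets of \<open>Basis\<close>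
  guarantees that, before each step, there are fewer vectors than the dimension, so some vector lies
  outside their span.\<close>

lemma ex_form_orthonormal_family:
  fixes g :: "'a::euclidean_space \<Rightarrow> 'a \<Rightarrow> real"
  assumes g: "bilinear g" and sym: "\<And>x y. g x y = g y x" and pos: "\<And>x. x \<noteq> 0 \<Longrightarrow> g x x > 0"
    and "finite I" "I \<subseteq> (Basis :: 'a set)"
  shows "\<exists>f. \<forall>i\<in>I. \<forall>j\<in>I. g (f i) (f j) = (if i = j then 1 else 0)"
  using assms(4,5)
proof (induction I rule: finite_induct)
  case (insert k I)
  then obtain f where f: "\<And>i j. i \<in> I \<Longrightarrow> j \<in> I \<Longrightarrow> g (f i) (f j) = (if i = j then 1 else 0)"
    by auto
  have "card I < card (insert k I)" using insert by simp
  also have "\<dots> \<le> DIM('a)" using insert.prems by (intro card_mono) auto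
  finally have "dim (span (f ` I)) < DIM('a)"
    using dim_le_card[of "f ` I" "f ` I"] card_image_le[OF insert.hyps(1), of f] insert.hyps(1)
    by (simp add: span_superset)
  then have "span (f ` I) \<noteq> UNIV" by (metis dim_UNIV less_irrefl)
  then obtain v where v: "v \<notin> span (f ` I)" by blast
  define w where "w = v - (\<Sum>i\<in>I. g v (f i) *\<^sub>R f i)"
  define u where "u = (1 / sqrt (g w w)) *\<^sub>R w"
  have "(\<Sum>i\<in>I. g v (f i) *\<^sub>R f i) \<in> span (f ` I)"
    by (intro span_sum span_mul span_base) auto
  then have "w \<noteq> 0" using v by (auto simp: w_def)
  then have ww: "g w w > 0" by (rule pos)
  have lin: "linear (\<lambda>x. g x y)" for y using g by (simp add: bilinear_def)
  have wj: "g w (f j) = 0" if "j \<in> I" for j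
  proof -
    have "g w (f j) = g v (f j) - (\<Sum>i\<in>I. g v (f i) * g (f i) (f j))"
      by (simp only: w_def linear_diff[OF lin] linear_sum[OF lin] linear_cmul[OF lin] real_scaleR_def)
    also have "(\<Sum>i\<in>I. g v (f i) * g (f i) (f j)) = (\<Sum>i\<in>I. if i = j then g v (f j) else 0)"
      by (rule sum.cong) (auto simp: f that)
    also have "\<dots> = g v (f j)" using that insert.hyps(1) by simp
    finally show ?thesis by simp
  qed
  have uj: "g u (f j) = 0" "g (f j) u = 0" if "j \<in> I" for j
    using wj[OF that] sym[of "f j" u] by (simp_all add: u_def bilinear_lmul[OF g])
  have uu: "g u u = 1"
    using ww by (simp add: u_def bilinear_lmul[OF g] bilinear_rmul[OF g] field_simps)
  show ?case
    by (rule exI[of _ "f(k := u)"]) (use f uj uu insert.hyps(2) in auto)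
qed simp

text \<open>\<open>S\<close> sends the standard basis to a \<open>g\<close>-orthonormal one. It is
  injective because \<open>g (S x) (S x)\<close> recovers the norm of \<open>x\<close>.\<close>

lemma ex_linear_bij_positive_form:
  fixes g :: "'a::euclidean_space \<Rightarrow> 'a \<Rightarrow> real"
  assumes g: "bilinear g" and sym: "\<And>x y. g x y = g y x" and pos: "\<And>x. x \<noteq> 0 \<Longrightarrow> g x x > 0"
  obtains S :: "'a \<Rightarrow> 'a" where "linear S" "bij S" "\<And>x. g (S x) (S x) = (norm x)\<^sup>2"
proof -
  obtain f :: "'a \<Rightarrow> 'a" where f: "\<And>i j. i \<in> Basis \<Longrightarrow> j \<in> Basis \<Longrightarrow> g (f i) (f j) = (if i = j then 1 else 0)"
    using ex_form_orthonormal_family[OF g sym pos finite_Basis subset_refl] by metis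
  define S where "S x = (\<Sum>i\<in>Basis. (x \<bullet> i) *\<^sub>R f i)" for x
  have lin: "linear S"
    unfolding S_def by (rule linearI) (simp_all add: inner_left_distrib scaleR_add_left sum.distrib scaleR_sum_right)
  have nrm: "g (S x) (S x) = (norm x)\<^sup>2" for x
  proof -
    have "g (S x) (S x) = (\<Sum>(i,j)\<in>Basis\<times>Basis. g ((x \<bullet> i) *\<^sub>R f i) ((x \<bullet> j) *\<^sub>R f j))"
      unfolding S_def by (rule bilinear_sum[OF g])
    also have "\<dots> = (\<Sum>i\<in>Basis. \<Sum>j\<in>Basis. if j = i then (x \<bullet> i) * (x \<bullet> i) else 0)"
      unfolding sum.cartesian_product[symmetric]
      by (intro sum.cong refl) (auto simp: bilinear_lmul[OF g] bilinear_rmul[OF g] f)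
    also have "\<dots> = (norm x)\<^sup>2"
      by (simp add: power2_norm_eq_inner euclidean_inner[of x x])
    finally show ?thesis .
  qed
  have "x = 0" if "S x = 0" for x
    using nrm[of x] that bilinear_lzero[OF g] by simp
  then have "inj S" using lin linear_injective_0 by blast
  then have "bij S" using lin linear_injective_imp_surjective by (auto simp: bij_def)
  from that[OF lin this nrm] show ?thesis .
qed

subsection \<open>Power series of rational maps\<close>

text \<open>Analyticity with an arbitrary normed codomain, so that the scalar factor
  \<open>1 / (1 + Q x)\<close> and vector-valued maps are treated alike.\<close>

definition power_series_at_0 :: "(real^'m \<Rightarrow> 'b::real_normed_vector) \<Rightarrow> bool" where
  "power_series_at_0 f \<longleftrightarrow> (\<exists>c r. r > 0 \<and>
     (\<forall>x. norm x < r \<longrightarrow> ((\<lambda>\<alpha>. monomial_at x \<alpha> *\<^sub>R c \<alpha>) has_sum f x) UNIV))"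

lemma real_analytic_at_0_iff: "real_analytic_at_0 f \<longleftrightarrow> power_series_at_0 f"
  by (simp add: real_analytic_at_0_def power_series_at_0_def monomial_at_def)

lemma power_series_at_0_zero: "power_series_at_0 (\<lambda>x. 0)"
  unfolding power_series_at_0_def by (intro exI[of _ "\<lambda>_. 0"] exI[of _ 1]) simp

lemma power_series_at_0_add:
  assumes "power_series_at_0 f" "power_series_at_0 g"
  shows "power_series_at_0 (\<lambda>x. f x + g x)"
proof -
  from assms obtain c r d s where "r > 0" "s > 0"
    and f: "\<And>x. norm x < r \<Longrightarrow> ((\<lambda>\<alpha>. monomial_at x \<alpha> *\<^sub>R c \<alpha>) has_sum f x) UNIV"
    and g: "\<And>x. norm x < s \<Longrightarrow> ((\<lambda>\<alpha>. monomial_at x \<alpha> *\<^sub>R d \<alpha>) has_sum g x) UNIV"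
    unfolding power_series_at_0_def by blast
  then show ?thesis unfolding power_series_at_0_def
    by (intro exI[of _ "\<lambda>\<alpha>. c \<alpha> + d \<alpha>"] exI[of _ "min r s"])
      (auto simp: scaleR_add_right intro!: has_sum_add)
qed

lemma power_series_at_0_sum:
  assumes "finite I" "\<And>i. i \<in> I \<Longrightarrow> power_series_at_0 (f i)"
  shows "power_series_at_0 (\<lambda>x. \<Sum>i\<in>I. f i x)"
  using assms
  by (induction I rule: finite_induct) (auto intro: power_series_at_0_zero power_series_at_0_add)

lemma power_series_at_0_scaleR_left:
  fixes f :: "real^'m \<Rightarrow> real"
  assumes "power_series_at_0 f"
  shows "power_series_at_0 (\<lambda>x. f x *\<^sub>R v)"
proof -
  from assms obtain c r where "r > 0"
    and f: "\<And>x. norm x < r \<Longrightarrow> ((\<lambda>\<alpha>. monomial_at x \<alpha> *\<^sub>R c \<alpha>) has_sum f x) UNIV"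
    unfolding power_series_at_0_def by blast
  have "((\<lambda>\<alpha>. monomial_at x \<alpha> *\<^sub>R (c \<alpha> *\<^sub>R v)) has_sum f x *\<^sub>R v) UNIV" if "norm x < r" for x
    using has_sum_bounded_linear[OF bounded_linear_scaleR_left f[OF that]] by simp
  with \<open>r > 0\<close> show ?thesis unfolding power_series_at_0_def
    by (intro exI[of _ "\<lambda>\<alpha>. c \<alpha> *\<^sub>R v"] exI[of _ r]) auto
qed

text \<open>Multiplication by \<open>x $ i\<close> raises the exponent of that variable by one, an
  injective shift of the coefficients. Repeated use replaces a general product of power
  series.\<close>

lemma power_series_at_0_coordinate_scaleR:
  assumes "power_series_at_0 f"
  shows "power_series_at_0 (\<lambda>x. x $ i *\<^sub>R f x)"
proof -
  from assms obtain c r where "r > 0"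
    and f: "\<And>x. norm x < r \<Longrightarrow> ((\<lambda>\<alpha>. monomial_at x \<alpha> *\<^sub>R c \<alpha>) has_sum f x) UNIV"
    unfolding power_series_at_0_def by blast
  define up where "up \<alpha> = \<alpha>(i := Suc (\<alpha> i))" for \<alpha> :: "'a \<Rightarrow> nat"
  define down where "down \<alpha> = \<alpha>(i := \<alpha> i - 1)" for \<alpha> :: "'a \<Rightarrow> nat"
  \<comment> \<open>The subtraction in \<open>down\<close> is truncated, so exponents without the
    variable \<open>i\<close>, which \<open>up\<close> misses, get the coefficient 0.\<close>
  define d where "d \<beta> = (if \<beta> i = 0 then 0 else c (down \<beta>))" for \<beta>
  have du: "d (up \<alpha>) = c \<alpha>" for \<alpha> by (simp add: d_def up_def down_def)
  have inj: "inj up"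
    by (rule inj_on_inverseI[of _ down]) (simp add: up_def down_def)
  have mono: "monomial_at x (up \<alpha>) = x $ i * monomial_at x \<alpha>" for x \<alpha>
  proof -
    have "(\<Prod>j\<in>UNIV-{i}. x $ j ^ up \<alpha> j) = (\<Prod>j\<in>UNIV-{i}. x $ j ^ \<alpha> j)"
      by (rule prod.cong) (auto simp: up_def)
    then show ?thesis
      using prod.remove[of UNIV i "\<lambda>j. x $ j ^ up \<alpha> j"] prod.remove[of UNIV i "\<lambda>j. x $ j ^ \<alpha> j"]
      by (simp add: monomial_at_def up_def)
  qed
  have "((\<lambda>\<beta>. monomial_at x \<beta> *\<^sub>R d \<beta>) has_sum x $ i *\<^sub>R f x) UNIV" if "norm x < r" for x
  proof -
    have "((\<lambda>\<alpha>. x $ i *\<^sub>R monomial_at x \<alpha> *\<^sub>R c \<alpha>) has_sum x $ i *\<^sub>R f x) UNIV"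
      by (rule has_sum_bounded_linear[OF bounded_linear_scaleR_right f[OF that]])
    then have "((\<lambda>\<beta>. monomial_at x \<beta> *\<^sub>R d \<beta>) has_sum x $ i *\<^sub>R f x) (range up)"
      by (simp add: has_sum_reindex[OF inj] o_def mono du)
    moreover have "d \<beta> = 0" if "\<beta> \<notin> range up" for \<beta>
    proof -
      have "\<beta> i \<noteq> 0 \<Longrightarrow> \<beta> = up (down \<beta>)" by (auto simp: up_def down_def)
      then show ?thesis using that by (auto simp: d_def)
    qed
    ultimately show ?thesis
      by (subst has_sum_cong_neutral[where S = UNIV and T = "range up"]) auto
  qed
  with \<open>r > 0\<close> show ?thesis unfolding power_series_at_0_def by blast
qed

section \<open>Geometric series as sums over words\<close>

lemma finite_lists_of_length: "finite {l :: 'a::finite list. length l = n}"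
  using finite_lists_length_eq[of "UNIV :: 'a set" n] by simp

text \<open>Expanding an \<open>n\<close>-th power without collecting terms yields one product for
  each word of length \<open>n\<close>.\<close>

lemma sum_prod_list_length:
  fixes h :: "'a::finite \<Rightarrow> 'b::comm_semiring_1"
  shows "(\<Sum>l | length l = n. prod_list (map h l)) = (\<Sum>k\<in>UNIV. h k) ^ n"
proof (induction n)
  case (Suc n)
  have "{l :: 'a list. length l = Suc n} = (\<lambda>(k, l). k # l) ` (UNIV \<times> {l. length l = n})"
    by (auto simp: length_Suc_conv)
  then have "(\<Sum>l | length l = Suc n. prod_list (map h l))
      = (\<Sum>(k, l)\<in>UNIV \<times> {l. length l = n}. h k * prod_list (map h l))"
    by (simp add: sum.reindex inj_on_def case_prod_unfold)
  also have "\<dots> = (\<Sum>k\<in>UNIV. h k) * (\<Sum>l | length l = n. prod_list (map h l))"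
    by (simp add: sum.cartesian_product[symmetric] sum_product)
  finally show ?case by (simp add: Suc)
qed simp

lemma has_sum_fibres:
  fixes f :: "'a \<Rightarrow> real"
  assumes "(f has_sum S) UNIV" "\<And>y. (f has_sum g y) {x. k x = y}"
  shows "(g has_sum S) UNIV"
proof (rule has_sum_SigmaD)
  show "((\<lambda>(y, x). f x) has_sum S) (Sigma UNIV (\<lambda>y. {x. k x = y}))"
    by (subst has_sum_reindex_bij_witness[of _ "\<lambda>x. (k x, x)" snd UNIV f, OF _ _ _ _ _ refl])
      (use assms(1) in auto)
  show "((\<lambda>x. (case (y, x) of (y, x) \<Rightarrow> f x)) has_sum g y) {x. k x = y}" for y
    using assms(2) by simp
qed

text \<open>Finite partial sums of absolute values are bounded by the geometric series in
  \<open>\<Sum>k\<in>UNIV. \<bar>h k\<bar>\<close>; once summability is known, grouping words by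
  length gives the value.\<close>

lemma has_sum_geometric_lists:
  fixes h :: "'a::finite \<Rightarrow> real"
  assumes "(\<Sum>k\<in>UNIV. \<bar>h k\<bar>) < 1"
  shows "((\<lambda>l. prod_list (map h l)) has_sum 1 / (1 - (\<Sum>k\<in>UNIV. h k))) UNIV"
proof -
  let ?s = "\<Sum>k\<in>UNIV. \<bar>h k\<bar>"
  have s: "0 \<le> ?s" by (simp add: sum_nonneg)
  have abs_prod: "\<bar>prod_list (map h l)\<bar> = prod_list (map (\<lambda>k. \<bar>h k\<bar>) l)" for l
    by (induction l) (simp_all add: abs_mult)
  have bound: "(\<Sum>l\<in>F. \<bar>prod_list (map h l)\<bar>) \<le> 1 / (1 - ?s)" if F: "finite F" for F
  proof -
    obtain N where N: "\<And>l. l \<in> F \<Longrightarrow> length l < N"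
      using finite_nat_set_iff_bounded[of "length ` F"] F by auto
    have "(\<Sum>l\<in>F. \<bar>prod_list (map h l)\<bar>) \<le> (\<Sum>l\<in>(\<Union>n<N. {l. length l = n}). \<bar>prod_list (map h l)\<bar>)"
      by (rule sum_mono2) (use N in \<open>auto simp: finite_lists_of_length\<close>)
    also have "\<dots> = (\<Sum>n<N. \<Sum>l | length l = n. \<bar>prod_list (map h l)\<bar>)"
      by (rule sum.UNION_disjoint) (auto simp: finite_lists_of_length)
    also have "\<dots> = (\<Sum>n<N. ?s ^ n)" by (simp add: abs_prod sum_prod_list_length)
    also have "\<dots> \<le> (\<Sum>n. ?s ^ n)"
      by (rule sum_le_suminf) (use s assms in \<open>auto intro: summable_geometric\<close>)
    also have "\<dots> = 1 / (1 - ?s)" by (rule suminf_geometric) (use s assms in auto)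
    finally show ?thesis .
  qed
  have "(\<lambda>l. norm (prod_list (map h l))) summable_on UNIV"
    unfolding abs_summable_iff_bdd_above by (rule bdd_aboveI2[of _ _ "1 / (1 - ?s)"]) (use bound in auto)
  then have "(\<lambda>l. prod_list (map h l)) summable_on UNIV" by (rule abs_summable_summable)
  then obtain S where S: "((\<lambda>l. prod_list (map h l)) has_sum S) UNIV" by (auto simp: summable_on_def)
  have "((\<lambda>n. (\<Sum>k\<in>UNIV. h k) ^ n) has_sum S) UNIV"
    by (rule has_sum_fibres[OF S, where k = length])
      (simp add: has_sum_finite_iff finite_lists_of_length sum_prod_list_length)
  then have "(\<lambda>n. (\<Sum>k\<in>UNIV. h k) ^ n) sums S" by (rule has_sum_imp_sums)
  moreover have "\<bar>\<Sum>k\<in>UNIV. h k\<bar> < 1" using sum_abs[of h UNIV] assms by linarith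
  then have "(\<lambda>n. (\<Sum>k\<in>UNIV. h k) ^ n) sums (1 / (1 - (\<Sum>k\<in>UNIV. h k)))"
    by (intro geometric_sums) simp
  ultimately show ?thesis using S sums_unique2 by blast
qed

lemma linear_coordinates:
  fixes f :: "real^'m \<Rightarrow> 'b::real_vector"
  assumes "linear f"
  shows "f x = (\<Sum>i\<in>UNIV. x $ i *\<^sub>R f (axis i 1))"
proof -
  have "f x = f (\<Sum>i\<in>UNIV. x $ i *\<^sub>R axis i 1)"
    using basis_expansion[of x] by (simp add: scalar_mult_eq_scaleR)
  then show ?thesis using assms by (simp add: linear_sum linear_cmul)
qed

lemma bilinear_coordinates:
  fixes b :: "real^'m \<Rightarrow> real^'m \<Rightarrow> 'b::real_vector"
  assumes "bilinear b"
  shows "b x y = (\<Sum>i\<in>UNIV. \<Sum>j\<in>UNIV. x $ i *\<^sub>R y $ j *\<^sub>R b (axis i 1) (axis j 1))"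
proof -
  have "b x y = (\<Sum>i\<in>UNIV. x $ i *\<^sub>R b (axis i 1) y)"
    by (rule linear_coordinates) (use assms in \<open>simp add: bilinear_def\<close>)
  also have "\<dots> = (\<Sum>i\<in>UNIV. x $ i *\<^sub>R (\<Sum>j\<in>UNIV. y $ j *\<^sub>R b (axis i 1) (axis j 1)))"
    by (intro sum.cong refl arg_cong2[where f = scaleR] linear_coordinates)
      (use assms in \<open>simp add: bilinear_def\<close>)
  finally show ?thesis by (simp add: scaleR_sum_right)
qed

text \<open>
  The geometric series in \<open>- Q = \<Sum>i j. a\<^sub>i\<^sub>j x\<^sub>i x\<^sub>j\<close> is summed over words in the letters \<open>(i, j)\<close>, which are then
  grouped by the exponent of the resulting monomial.
\<close>

lemma power_series_at_0_inverse_quadratic: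
  fixes Q :: "real^'m \<Rightarrow> real"
  assumes "homogeneous_quadratic Q"
  shows "power_series_at_0 (\<lambda>x. 1 / (1 + Q x))"
proof -
  from assms obtain b where b: "bilinear b" and Q: "\<And>x. Q x = b x x"
    unfolding homogeneous_quadratic_def by blast
  define a where "a = (\<lambda>(i, j). - b (axis i (1::real) :: real^'m) (axis j 1))"
  define h where "h x = (\<lambda>(i, j). x $ i * x $ j * a (i, j))" for x :: "real^'m"
  \<comment> \<open>\<open>ex l\<close> is the exponent of the monomial spelled by the word
    \<open>l\<close>: each letter \<open>(i, j)\<close> contributes one factor from each of its two
    indices.\<close>
  define ex :: "('m \<times> 'm) list \<Rightarrow> 'm \<Rightarrow> nat" where
    "ex l k = (\<Sum>(i, j)\<leftarrow>l. of_bool (k = i) + of_bool (k = j))" for l k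
  have sum_h: "(\<Sum>k\<in>UNIV. h x k) = - Q x" for x
    unfolding Q bilinear_coordinates[OF b, of x x]
    by (simp add: h_def a_def UNIV_Times_UNIV[symmetric] sum.cartesian_product[symmetric] sum_negf mult.assoc del: UNIV_Times_UNIV)
  have prod_h: "prod_list (map (h x) l) = monomial_at x (ex l) * prod_list (map a l)" for x l
  proof (induction l)
    case Nil
    then show ?case by (simp add: monomial_at_def ex_def)
  next
    case (Cons p l)
    obtain i j where p: "p = (i, j)" by force
    have pw: "(\<Prod>k\<in>UNIV. x $ k ^ of_bool (k = m)) = x $ m" for m :: 'm
    proof -
      have "(\<Prod>k\<in>UNIV. x $ k ^ of_bool (k = m)) = (\<Prod>k\<in>UNIV. if k = m then x $ k else 1)"
        by (rule prod.cong) auto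
      then show ?thesis by simp
    qed
    have "monomial_at x (ex (p # l)) = x $ i * x $ j * monomial_at x (ex l)"
      by (simp add: monomial_at_def ex_def p power_add prod.distrib pw)
    then show ?case using Cons by (simp add: p) (simp add: h_def)
  qed
  have sum_ex: "sum (ex l) UNIV = 2 * length l" for l
    by (induction l) (auto simp: ex_def sum.distrib)
  \<comment> \<open>Each letter has degree two, so the exponent determines the length of the word
    and only finitely many words share it.\<close>
  have fin: "finite {l. ex l = \<alpha>}" for \<alpha>
    by (rule finite_subset[OF _ finite_lists_of_length[of "sum \<alpha> UNIV div 2"]]) (auto simp: sum_ex)
  define c where "c \<alpha> = (\<Sum>l | ex l = \<alpha>. prod_list (map a l))" for \<alpha>
  have ser: "((\<lambda>\<alpha>. monomial_at x \<alpha> *\<^sub>R c \<alpha>) has_sum 1 / (1 + Q x)) UNIV"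
    if "(\<Sum>k\<in>UNIV. \<bar>h x k\<bar>) < 1" for x
  proof (rule has_sum_fibres)
    show "((\<lambda>l. prod_list (map (h x) l)) has_sum 1 / (1 + Q x)) UNIV"
      using has_sum_geometric_lists[OF that] by (simp add: sum_h)
    show "((\<lambda>l. prod_list (map (h x) l)) has_sum monomial_at x \<alpha> *\<^sub>R c \<alpha>) {l. ex l = \<alpha>}" for \<alpha>
      by (simp add: has_sum_finite_iff fin prod_h c_def sum_distrib_left)
  qed
  have "\<exists>r>0. \<forall>x. norm x < r \<longrightarrow> (\<Sum>k\<in>UNIV. \<bar>h x k\<bar>) < 1"
  proof -
    have "isCont (\<lambda>x. \<Sum>k\<in>UNIV. \<bar>h x k\<bar>) 0"
      unfolding h_def case_prod_unfold by (intro continuous_intros)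
    then have "((\<lambda>x. \<Sum>k\<in>UNIV. \<bar>h x k\<bar>) \<longlongrightarrow> (\<Sum>k\<in>UNIV. \<bar>h 0 k\<bar>)) (at 0)"
      by (simp add: isCont_def)
    moreover have z: "(\<Sum>k\<in>UNIV. \<bar>h 0 k\<bar>) = 0" by (simp add: h_def case_prod_unfold)
    ultimately have "\<forall>\<^sub>F x in at 0. (\<Sum>k\<in>UNIV. \<bar>h x k\<bar>) < 1"
      by (metis order_tendstoD(2) zero_less_one)
    then obtain r where "r > 0" "\<And>x. x \<noteq> 0 \<Longrightarrow> norm x < r \<Longrightarrow> (\<Sum>k\<in>UNIV. \<bar>h x k\<bar>) < 1"
      unfolding eventually_at by (auto simp: dist_norm)
    with z show ?thesis by (metis zero_less_one)
  qed
  with ser show ?thesis unfolding power_series_at_0_def by blast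
qed

text \<open>In coordinates the map is a finite sum of constant vectors times
  \<open>1 / (1 + Q x)\<close> and one or two coordinates.\<close>

lemma power_series_at_0_quadratic_rational:
  fixes A B :: "real^'m \<Rightarrow> 'b::real_normed_vector"
  assumes A: "linear A" and B: "homogeneous_quadratic B" and Q: "homogeneous_quadratic Q"
  shows "power_series_at_0 (\<lambda>x. (1 / (1 + Q x)) *\<^sub>R (A x + B x))"
proof -
  from B obtain b where b: "bilinear b" and Bb: "\<And>x. B x = b x x"
    unfolding homogeneous_quadratic_def by blast
  let ?R = "\<lambda>x. 1 / (1 + Q x)"
  have eq: "?R x *\<^sub>R (A x + B x) = (\<Sum>i\<in>UNIV. x $ i *\<^sub>R ?R x *\<^sub>R A (axis i 1))
    + (\<Sum>i\<in>UNIV. \<Sum>j\<in>UNIV. x $ i *\<^sub>R x $ j *\<^sub>R ?R x *\<^sub>R b (axis i 1) (axis j 1))" for x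
  proof -
    have "?R x *\<^sub>R A x = (\<Sum>i\<in>UNIV. x $ i *\<^sub>R ?R x *\<^sub>R A (axis i 1))"
      by (subst linear_coordinates[OF A]) (simp add: scaleR_sum_right mult.commute)
    moreover have "?R x *\<^sub>R B x = (\<Sum>i\<in>UNIV. \<Sum>j\<in>UNIV. x $ i *\<^sub>R x $ j *\<^sub>R ?R x *\<^sub>R b (axis i 1) (axis j 1))"
      unfolding Bb by (subst bilinear_coordinates[OF b]) (simp add: scaleR_sum_right mult_ac)
    ultimately show ?thesis by (simp only: scaleR_add_right)
  qed
  show ?thesis unfolding eq
    by (intro power_series_at_0_add power_series_at_0_sum power_series_at_0_coordinate_scaleR
        power_series_at_0_scaleR_left power_series_at_0_inverse_quadratic Q finite)
qed

subsection \<open>Lifting to spheres\<close>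

lemma homogeneous_quadratic_symmetric:
  assumes "homogeneous_quadratic Q"
  obtains b where "bilinear b" "\<And>x y. b x y = b y x" "\<And>x. Q x = b x x"
proof -
  from assms obtain b where b: "bilinear b" "\<And>x. Q x = b x x"
    unfolding homogeneous_quadratic_def by blast
  let ?b = "\<lambda>x y. (1/2) *\<^sub>R (b x y + b y x)"
  have "bilinear ?b"
    using b(1) unfolding bilinear_def linear_iff by (simp add: scaleR_add_right)
  moreover have "?b x y = ?b y x" for x y by (simp add: add.commute)
  moreover have "Q x = ?b x x" for x by (simp add: b(2) flip: scaleR_2)
  ultimately show ?thesis by (rule that)
qed

lemma homogeneous_quadratic_scaleR:
  "homogeneous_quadratic Q \<Longrightarrow> Q (t *\<^sub>R x) = t\<^sup>2 *\<^sub>R Q x"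
  unfolding homogeneous_quadratic_def by (auto simp: bilinear_lmul bilinear_rmul power2_eq_square)

lemma continuous_on_homogeneous_quadratic:
  fixes Q :: "'a::euclidean_space \<Rightarrow> 'b::euclidean_space"
  assumes "homogeneous_quadratic Q"
  shows "continuous_on S Q"
proof -
  from assms obtain b where b: "bilinear b" "\<And>x. Q x = b x x"
    unfolding homogeneous_quadratic_def by blast
  show ?thesis unfolding b(2)
    by (rule bounded_bilinear.continuous_on) (use b(1) in \<open>auto simp: bilinear_conv_bounded_bilinear\<close>)
qed

lemma homogeneous_quadratic_diff:
  assumes "homogeneous_quadratic P" "homogeneous_quadratic Q"
  shows "homogeneous_quadratic (\<lambda>x. P x - Q x)"
proof -
  from assms obtain b d where "bilinear b" "bilinear d" "\<And>x. P x = b x x" "\<And>x. Q x = d x x"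
    unfolding homogeneous_quadratic_def by blast
  then show ?thesis unfolding homogeneous_quadratic_def bilinear_def
    by (intro exI[of _ "\<lambda>x y. b x y - d x y"]) (simp add: linear_compose_sub)
qed

lemma homogeneous_quadratic_linear_scaleR:
  assumes "linear p" "linear A"
  shows "homogeneous_quadratic (\<lambda>x. p x *\<^sub>R A x)"
  unfolding homogeneous_quadratic_def bilinear_def using assms
  by (intro exI[of _ "\<lambda>x y. p x *\<^sub>R A y"]) (simp add: linear_iff scaleR_add_left scaleR_add_right)

lemma homogeneous_quadratic_compose_linear:
  assumes "homogeneous_quadratic Q" "linear S"
  shows "homogeneous_quadratic (Q \<circ> S)"
proof -
  from assms(1) obtain b where b: "bilinear b" "\<And>x. Q x = b x x"
    unfolding homogeneous_quadratic_def by blast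
  have "bilinear (\<lambda>x y. b (S x) (S y))"
    using b(1) assms(2) unfolding bilinear_def linear_iff by simp
  then show ?thesis unfolding homogeneous_quadratic_def
    by (intro exI[of _ "\<lambda>x y. b (S x) (S y)"]) (simp add: b(2))
qed

lemma isometric_identification_fst:
  "isometric_identification {z. ((0 :: 'a::euclidean_space), (1 :: real)) \<bullet> z = 0} fst"
  unfolding isometric_identification_def
proof (intro conjI ballI)
  show "bij_betw fst {z. ((0 :: 'a), (1 :: real)) \<bullet> z = 0} UNIV"
    by (rule bij_betwI[of _ _ _ "\<lambda>u. (u, 0)"]) auto
qed (auto simp: dist_Pair_Pair)

lemma snd_stereographic:
  fixes y :: "'a::euclidean_space \<times> real"
  assumes "snd y \<noteq> 1"
  shows "snd (stereographic (0, 1) 0 y) = 0"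
  using assms by (simp add: stereographic_def inner_prod_def field_simps)

text \<open>\<open>B\<close> and \<open>Q\<close> are the corrected second-order data, with the
  multiple of \<open>A\<close> already removed; \<open>Q_pos\<close> is the form that nondegeneracy
  takes for them.\<close>

locale sphere_lift =
  fixes A B :: "real^'m \<Rightarrow> real^'n" and Q :: "real^'m \<Rightarrow> real"
  assumes linear_A: "linear A" and quad_B: "homogeneous_quadratic B" and quad_Q: "homogeneous_quadratic Q"
    and A_B: "\<And>x. A x \<bullet> B x = 0" and B_B: "\<And>x. B x \<bullet> B x = Q x * (A x \<bullet> A x)"
    and Q_nonneg: "\<And>x. Q x \<ge> 0" and Q_pos: "\<And>x. x \<noteq> 0 \<Longrightarrow> A x = 0 \<Longrightarrow> Q x \<noteq> 0"
begin

definition G where "G = (\<lambda>(x, t). t\<^sup>2 + Q x + A x \<bullet> A x)"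

text \<open>Inverse stereographic projection from \<open>(0, 1)\<close> sends \<open>u\<close> to
  \<open>(2 u, |u|^2 - 1)\<close> divided by \<open>|u|^2 + 1\<close>. For
  \<open>u = (A x + B x) / (1 + Q x)\<close> one has \<open>|u|^2 = |A x|^2 / (1 + Q x)\<close>;
  clearing denominators and homogenising with \<open>t\<close> gives \<open>F\<close>, with
  \<open>G\<close> as the denominator.\<close>

definition F where
  "F = (\<lambda>(x, t). (2 *\<^sub>R (t *\<^sub>R A x + B x), A x \<bullet> A x - t\<^sup>2 - Q x))"

text \<open>By orthogonality \<open>t *\<^sub>R A x + B x\<close> has squared norm
  \<open>(t\<^sup>2 + Q x) * (A x \<bullet> A x)\<close>, so the claim is
  \<open>4 u v + (u - v)^2 = (u + v)^2\<close>.\<close>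

lemma norm_F: "norm (F z) = G z"
proof -
  obtain x t where z: "z = (x, t)" by force
  have "F z \<bullet> F z = (G z)\<^sup>2"
    by (simp add: z F_def G_def inner_add inner_commute A_B B_B)
      (simp add: algebra_simps power2_eq_square)
  moreover have "G z \<ge> 0" by (simp add: z G_def Q_nonneg)
  ultimately show ?thesis by (simp add: norm_eq_sqrt_inner)
qed

lemma quadratic_F: "homogeneous_quadratic F"
proof -
  obtain b where b: "bilinear b" "\<And>x y. b x y = b y x" "\<And>x. B x = b x x"
    using homogeneous_quadratic_symmetric[OF quad_B] by metis
  obtain k where k: "bilinear k" "\<And>x y. k x y = k y x" "\<And>x. Q x = k x x"
    using homogeneous_quadratic_symmetric[OF quad_Q] by metis
  let ?f = "\<lambda>(x, t) (y, s). (2 *\<^sub>R (t *\<^sub>R A y + b x y), A x \<bullet> A y - t * s - k x y)"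
  have "bilinear ?f"
    using b(1) k(1) linear_A unfolding bilinear_def linear_iff
    by (auto simp: algebra_simps inner_add)
  then show ?thesis unfolding homogeneous_quadratic_def
    by (intro exI[of _ ?f]) (auto simp: F_def b(3) k(3) power2_eq_square)
qed

text \<open>All three summands of \<open>G\<close> are nonnegative. If they vanish together, then
  \<open>t = 0\<close> and \<open>A x = 0\<close>, and \<open>Q_pos\<close> forces
  \<open>x = 0\<close>; hence \<open>G\<close> is positive definite.\<close>

lemma ex_sphere_coordinates:
  obtains S :: "(real^'m) \<times> real \<Rightarrow> (real^'m) \<times> real"
  where "linear S" "bij S" "\<And>z. G (S z) = (norm z)\<^sup>2"
proof -
  obtain k where k: "bilinear k" "\<And>x y. k x y = k y x" "\<And>x. Q x = k x x"
    using homogeneous_quadratic_symmetric[OF quad_Q] by metis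
  let ?g = "\<lambda>z w. snd z * snd w + k (fst z) (fst w) + A (fst z) \<bullet> A (fst w)"
  have g1: "bilinear ?g"
    using k(1) linear_A unfolding bilinear_def linear_iff
    by (auto simp: algebra_simps inner_add)
  have g2: "?g z w = ?g w z" for z w by (simp add: k(2) inner_commute mult.commute)
  have g3: "?g z z > 0" if "z \<noteq> 0" for z
  proof (cases "snd z = 0 \<and> A (fst z) = 0")
    case True
    with that have "fst z \<noteq> 0" by (simp add: prod_eq_iff)
    then show ?thesis using True Q_pos[of "fst z"] Q_nonneg[of "fst z"] by (simp add: k(3))
  next
    case False
    then have "snd z * snd z + A (fst z) \<bullet> A (fst z) > 0"
      by (metis add_nonneg_pos add_pos_nonneg inner_ge_zero inner_gt_zero_iff not_square_less_zero
          linorder_neqE_linordered_idom mult_eq_0_iff not_less)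
    then show ?thesis using Q_nonneg[of "fst z"] by (simp add: k(3)[symmetric])
  qed
  show thesis
  proof (rule ex_linear_bij_positive_form[of ?g, OF g1 g2 g3])
    fix S :: "(real^'m) \<times> real \<Rightarrow> (real^'m) \<times> real"
    assume S: "linear S" "bij S" "\<And>z. ?g (S z) (S z) = (norm z)\<^sup>2"
    have "G (S z) = (norm z)\<^sup>2" for z
      unfolding S(3)[symmetric] by (simp add: G_def case_prod_unfold k(3) power2_eq_square)
    with S(1,2) show thesis by (rule that)
  qed
qed

lemma stereographic_F:
  "stereographic (0, 1) 0 ((1 / G (x, 1)) *\<^sub>R F (x, 1)) = ((1 / (1 + Q x)) *\<^sub>R (A x + B x), 0)"
proof -
  have q: "1 + Q x > 0" using Q_nonneg[of x] by simp
  then have G: "G (x, 1) > 0" by (simp add: G_def add_pos_nonneg)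
  let ?y = "(1 / G (x, 1)) *\<^sub>R F (x, 1)"
  have 1: "1 - (0, 1) \<bullet> ?y = 2 * (1 + Q x) / G (x, 1)"
    using G by (simp add: F_def field_simps) (simp add: G_def)
  have "fst (stereographic (0, 1) 0 ?y) = (G (x, 1) / (2 * (1 + Q x))) *\<^sub>R (2 / G (x, 1)) *\<^sub>R (A x + B x)"
    unfolding stereographic_def 1 by (simp add: F_def)
  also have "\<dots> = (1 / (1 + Q x)) *\<^sub>R (A x + B x)"
  proof -
    have "G (x, 1) / (2 * (1 + Q x)) * (2 / G (x, 1)) = 1 / (1 + Q x)"
      using G q by (simp add: divide_simps)
    then show ?thesis by (simp only: scaleR_scaleR)
  qed
  finally have "fst (stereographic (0, 1) 0 ?y) = (1 / (1 + Q x)) *\<^sub>R (A x + B x)" .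
  moreover have "snd (stereographic (0, 1) 0 ?y) = 0"
  proof -
    have "snd ?y = (0, 1) \<bullet> ?y" by (simp only: inner_prod_def) simp
    also have "\<dots> \<noteq> 1" using 1 G q by auto
    finally show ?thesis by (rule snd_stereographic)
  qed
  ultimately show ?thesis by (simp add: prod_eq_iff)
qed

text \<open>With \<open>f = F \<circ> S\<close> the norm of \<open>f z\<close> is
  \<open>G (S z)\<close>, that is \<open>(norm z)\<^sup>2\<close>, so \<open>f\<close> preserves the
  unit sphere. The affine embedding is \<open>x \<mapsto> (x, 1)\<close> followed by the inverse of
  \<open>S\<close>, which \<open>f\<close> undoes.\<close>

theorem factors_through_quadratic:
  "\<exists>f :: (real^'m) \<times> real \<Rightarrow> (real^'n) \<times> real. quadratic_sphere_map f \<and>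
     germ_factors_through (\<lambda>x. (1 / (1 + Q x)) *\<^sub>R (A x + B x)) f"
proof -
  obtain S :: "(real^'m) \<times> real \<Rightarrow> (real^'m) \<times> real"
    where S: "linear S" "bij S" "\<And>z. G (S z) = (norm z)\<^sup>2"
    by (rule ex_sphere_coordinates) blast
  define T where "T = inv S"
  have ST: "S (T z) = z" for z using S(2) by (simp add: T_def bij_is_surj surj_f_inv_f)
  have T: "linear T" unfolding T_def
    using S(1,2) inj_linear_imp_inv_linear bij_is_inj by blast
  define f where "f = F \<circ> S"
  have quad: "homogeneous_quadratic f"
    unfolding f_def by (rule homogeneous_quadratic_compose_linear[OF quadratic_F S(1)])
  have sphere: "quadratic_sphere_map f"
    unfolding quadratic_sphere_map_def
    using quad by (auto simp: f_def norm_F S(3))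
  define E where "E x = T (x, 1)" for x :: "real^'m"
  have SE: "S (E x) = (x, 1)" for x by (simp add: E_def ST)
  have G_pos: "G (x, 1) > 0" for x
    using Q_nonneg[of x] by (simp add: G_def add_pos_nonneg)
  have nE: "(norm (E x))\<^sup>2 = G (x, 1)" for x using S(3)[of "E x"] by (simp add: SE)
  have E0: "E x \<noteq> 0" for x using G_pos[of x] nE[of x] by auto
  have fE: "f (sgn (E x)) = (1 / G (x, 1)) *\<^sub>R F (x, 1)" for x
  proof -
    \<comment> \<open>By degree two, radial projection divides the value by
      \<open>(norm (E x))\<^sup>2\<close>, which is exactly the normaliser
      \<open>G (x, 1)\<close>.\<close>
    have "f (sgn (E x)) = (1 / norm (E x))\<^sup>2 *\<^sub>R f (E x)"
      using homogeneous_quadratic_scaleR[OF quad] by (simp add: sgn_div_norm inverse_eq_divide)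
    also have "f (E x) = F (x, 1)" by (simp add: f_def SE)
    finally show ?thesis by (simp add: power_divide nE)
  qed
  have aff: "affine_embedding E"
    unfolding affine_embedding_def
  proof (intro exI conjI allI)
    show "linear (\<lambda>x. T (x, 0))" using T by (simp add: linear_iff) (metis add.right_neutral add_Pair mult_zero_right scaleR_Pair real_scaleR_def)
    show "inj (\<lambda>x. T (x, 0))"
      by (rule inj_on_inverseI[of _ "\<lambda>z. fst (S z)"]) (simp add: ST)
    show "E x = T (0, 1) + T (x, 0)" for x
      using linear_add[OF T, of "(0, 1)" "(x, 0)"] by (simp add: E_def)
  qed
  \<comment> \<open>Reaching the pole would require \<open>- 1 - Q x = 1 + Q x\<close>, against
    \<open>Q x \<ge> 0\<close>.\<close>
  have "f (sgn (E x)) \<noteq> (0, 1)" for x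
  proof
    assume "f (sgn (E x)) = (0, 1)"
    then have "A x \<bullet> A x - 1 - Q x = G (x, 1)"
      unfolding fE using G_pos[of x] by (simp add: F_def field_simps)
    then show False using Q_nonneg[of x] by (simp add: G_def)
  qed
  then have "factors_through_on UNIV (\<lambda>x. (1 / (1 + Q x)) *\<^sub>R (A x + B x)) f"
    unfolding factors_through_on_def
    by (intro exI[of _ E] exI[of _ "(0, 1)"] exI[of _ 0] exI[of _ fst])
      (auto simp: aff E0 fE stereographic_F isometric_identification_fst norm_Pair)
  then show ?thesis using sphere unfolding germ_factors_through_def
    by (intro exI[of _ f]) (auto intro: exI[of _ UNIV])
qed

end

subsection \<open>Roundings\<close>

lemma vector_line_span_singleton: "x \<noteq> 0 \<Longrightarrow> vector_line (span {x})"
  by (simp add: vector_line_def dim_span_eq_card_independent)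

lemma vector_line_cases:
  assumes "vector_line l"
  obtains x where "x \<noteq> 0" "l = span {x}"
proof -
  have l: "subspace l" "dim l = 1" using assms by (auto simp: vector_line_def)
  then have "l \<noteq> {0}" by auto
  then obtain x where x: "x \<in> l" "x \<noteq> 0" using l(1) subspace_0 by blast
  have "l \<subseteq> span {x}" using l x by (intro card_ge_dim_independent) auto
  moreover have "span {x} \<subseteq> l" using l x by (intro span_minimal) auto
  ultimately show ?thesis using that x by blast
qed

lemma ex_unit_image_and_independent:
  fixes A :: "'a::euclidean_space \<Rightarrow> 'b::euclidean_space"
  assumes A: "linear A" and rank: "dim (range A) \<ge> 2"
  obtains e v where "A e \<bullet> A e = 1" "\<And>k. A v \<noteq> k *\<^sub>R A e"
proof -
  have small: "\<not> range A \<subseteq> span {w}" for w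
  proof
    assume "range A \<subseteq> span {w}"
    then have "dim (range A) \<le> card {w}" by (rule dim_le_card) simp
    with rank show False by simp
  qed
  obtain u where u: "A u \<noteq> 0" using small[of 0] by auto
  define e where "e = (1 / norm (A u)) *\<^sub>R u"
  have "A e = (1 / norm (A u)) *\<^sub>R A u" by (simp add: e_def linear_cmul[OF A])
  then have "A e \<bullet> A e = 1" using u by (simp add: dot_square_norm power2_eq_square)
  moreover obtain v where "\<And>k. A v \<noteq> k *\<^sub>R A e"
    using small[of "A e"] by (auto simp: span_singleton)
  ultimately show ?thesis by (rule that)
qed

locale rounding_series =
  fixes \<Phi> :: "real^'m \<Rightarrow> real^'n" and c r
  assumes rounding: "rounding \<Phi>" and radius: "r > 0"
    and series: "\<And>x. norm x < r \<Longrightarrow> ((\<lambda>\<alpha>. monomial_at x \<alpha> *\<^sub>R c \<alpha>) has_sum \<Phi> x) UNIV"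
begin

abbreviation "H \<equiv> homogeneous_part c"

lemma \<Phi>_0: "\<Phi> 0 = 0"
  using rounding by (simp add: rounding_def)

lemma H_0: "H 0 x = 0"
proof -
  obtain K \<rho> where "\<rho> > 0" "\<And>x. norm x \<le> \<rho> \<Longrightarrow> norm (\<Phi> x - (\<Sum>k<1. H k x)) \<le> K * norm x ^ 1"
    using power_series_jet[OF radius series, of 1] by blast
  from this(2)[of 0] this(1) have "H 0 0 = 0" by (simp add: \<Phi>_0)
  moreover have "H 0 0 = H 0 x" using homogeneous_part_scaleR[of c 0 0 x] by simp
  ultimately show ?thesis by simp
qed

lemma linear_H1: "linear (H 1)"
  by (rule linear_homogeneous_part)

lemma derivative: "(\<Phi> has_derivative H 1) (at 0)"
proof -
  obtain K \<rho> where "\<rho> > 0" "\<And>x. norm x \<le> \<rho> \<Longrightarrow> norm (\<Phi> x - (\<Sum>k<2. H k x)) \<le> K * norm x ^ 2"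
    using power_series_jet[OF radius series, of 2] by blast
  then show ?thesis
    by (intro has_derivative_of_quadratic_remainder[where f = \<Phi> and \<rho> = \<rho> and K = K, OF linear_H1 \<Phi>_0])
      (auto simp: numeral_2_eq_2 H_0)
qed

lemma two_jet: "has_2jet \<Phi> (H 1) (H 2)"
proof -
  obtain K \<rho> where "\<rho> > 0" "\<And>x. norm x \<le> \<rho> \<Longrightarrow> norm (\<Phi> x - (\<Sum>k<3. H k x)) \<le> K * norm x ^ 3"
    using power_series_jet[OF radius series, of 3] by blast
  then show ?thesis
    by (intro has_2jet_of_cubic_remainder[where \<Phi> = \<Phi> and \<rho> = \<rho> and K = K, OF linear_H1 quadratic_homogeneous_part \<Phi>_0])
      (auto simp: eval_nat_numeral H_0)
qed

lemma rank: "dim (range (H 1)) \<ge> 2"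
  using rounding frechet_derivative_at[OF derivative] by (simp add: rounding_def)

text \<open>The germ condition is pulled back along \<open>t \<mapsto> t *\<^sub>R x\<close>; by
  homogeneity the order-five remainder in \<open>x\<close> becomes one in \<open>t\<close>, and the
  degree-zero part drops out by \<open>H_0\<close>.\<close>

lemma curve_on_circle_line:
  assumes "H 1 x \<noteq> 0" "is_circle S" "germ_image_in \<Phi> (span {x}) S"
  shows "curve_on_circle (\<lambda>t. \<Phi> (t *\<^sub>R x)) (H 1 x) (H 2 x) (H 3 x) (H 4 x) S"
proof
  have "((\<lambda>t::real. t *\<^sub>R x) \<longlongrightarrow> 0) (nhds 0)"
    using tendsto_at_iff_tendsto_nhds[of "\<lambda>t::real. t *\<^sub>R x" 0] by (auto intro!: tendsto_eq_intros)
  then have lim: "filterlim (\<lambda>t::real. t *\<^sub>R x) (nhds 0) (nhds 0)" .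
  from assms(3) have "\<forall>\<^sub>F t in nhds 0. t *\<^sub>R x \<in> span {x} \<longrightarrow> \<Phi> (t *\<^sub>R x) \<in> S"
    unfolding germ_image_in_def using eventually_compose_filterlim[OF _ lim] by blast
  then show "\<forall>\<^sub>F t in nhds 0. \<Phi> (t *\<^sub>R x) \<in> S"
    by (simp add: span_mul span_base)
  obtain K \<rho> where \<rho>: "\<rho> > 0" "\<And>x. norm x \<le> \<rho> \<Longrightarrow> norm (\<Phi> x - (\<Sum>k<5. H k x)) \<le> K * norm x ^ 5"
    using power_series_jet[OF radius series, of 5] by blast
  have sum: "(\<Sum>k<5. H k (t *\<^sub>R x)) = t *\<^sub>R H 1 x + t\<^sup>2 *\<^sub>R H 2 x + t ^ 3 *\<^sub>R H 3 x + t ^ 4 *\<^sub>R H 4 x" for t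
    by (simp add: eval_nat_numeral H_0 homogeneous_part_scaleR)
  from lim \<rho>(1) have "\<forall>\<^sub>F t in nhds 0. dist (t *\<^sub>R x) 0 < \<rho>" by (rule tendstoD)
  then have "\<forall>\<^sub>F t in at 0. dist (t *\<^sub>R x) 0 < \<rho>" by (simp add: eventually_nhds_conv_at)
  then have ev: "\<forall>\<^sub>F t in at 0. norm (norm (\<Phi> (t *\<^sub>R x) - (\<Sum>k<5. H k (t *\<^sub>R x)))) \<le> K * norm x ^ 5 * norm (t ^ 5)"
  proof eventually_elim
    case (elim t)
    then show ?case using \<rho>(2)[of "t *\<^sub>R x"] by (simp add: power_mult_distrib power_abs mult_ac)
  qed
  show "(\<lambda>t. norm (\<Phi> (t *\<^sub>R x) - (t *\<^sub>R H 1 x + t\<^sup>2 *\<^sub>R H 2 x + t ^ 3 *\<^sub>R H 3 x + t ^ 4 *\<^sub>R H 4 x)))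
      \<in> O[at 0](\<lambda>t. t ^ 5)"
    using bigoI[OF ev] by (simp only: sum)
qed (use assms \<Phi>_0 in auto)

lemma ex_circle:
  assumes "x \<noteq> 0"
  obtains S where "is_circle S" "germ_image_in \<Phi> (span {x}) S"
  using rounding vector_line_span_singleton[OF assms] unfolding rounding_def by blast

lemma ex_circular_jet:
  obtains b e v where "circular_jet (H 1) b (H 3) (H 4) e v" "\<And>x. H 2 x = b x x"
proof -
  obtain b where b: "bilinear b" "\<And>x y. b x y = b y x" "\<And>x. H 2 x = b x x"
    using homogeneous_quadratic_symmetric[OF quadratic_homogeneous_part[of c]] by metis
  obtain e v where ev: "H 1 e \<bullet> H 1 e = 1" "\<And>k. H 1 v \<noteq> k *\<^sub>R H 1 e"
    using ex_unit_image_and_independent[OF linear_H1 rank] by metis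
  have "circular_jet (H 1) b (H 3) (H 4) e v"
  proof (rule circular_jet.intro)
    fix x assume x: "H 1 x \<noteq> 0"
    then have "x \<noteq> 0" using linear_0[OF linear_H1] by auto
    then obtain S where S: "is_circle S" "germ_image_in \<Phi> (span {x}) S" by (rule ex_circle)
    from curve_on_circle.jet_relations[OF curve_on_circle_line[OF x S]]
    show "\<exists>\<alpha> \<beta> \<gamma> \<delta>. H 3 x = \<alpha> *\<^sub>R H 1 x + \<beta> *\<^sub>R b x x \<and> H 4 x = \<gamma> *\<^sub>R H 1 x + \<delta> *\<^sub>R b x x \<and>
        2 * (H 1 x \<bullet> b x x) = \<beta> * (H 1 x \<bullet> H 1 x) \<and>
        b x x \<bullet> b x x + 2 * (H 1 x \<bullet> H 3 x) = \<delta> * (H 1 x \<bullet> H 1 x)"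
      by (simp only: b(3))
  qed (use b ev linear_H1 homogeneous_part_on_line in blast)+
  then show ?thesis using b(3) by (rule that)
qed

lemma ex_quotients:
  obtains p q where "linear p" "homogeneous_quadratic q"
    "\<And>x. H 1 x \<bullet> H 2 x = p x * (H 1 x \<bullet> H 1 x)" "\<And>x. H 2 x \<bullet> H 2 x = q x * (H 1 x \<bullet> H 1 x)"
proof -
  obtain b e v where j: "circular_jet (H 1) b (H 3) (H 4) e v" and b: "\<And>x. H 2 x = b x x"
    by (rule ex_circular_jet) blast
  interpret circular_jet "H 1" b "H 3" "H 4" e v by (fact j)
  show ?thesis
    by (rule that[OF linear_p quadratic_q]) (simp_all only: b A_B_eq B_B_eq)
qed

end

text \<open>Quadratic maps have zero derivative at 0, so only \<open>A\<close> survives; this is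
  what gives the new map the rank of the original one.\<close>

lemma rational_has_derivative:
  fixes A B :: "'a::euclidean_space \<Rightarrow> 'b::euclidean_space"
  assumes A: "linear A" and B: "homogeneous_quadratic B" and Q: "homogeneous_quadratic Q"
  shows "((\<lambda>x. (1 / (1 + Q x)) *\<^sub>R (A x + B x)) has_derivative A) (at 0)"
proof -
  obtain b where b: "bounded_bilinear b" "\<And>x. B x = b x x"
    using B unfolding homogeneous_quadratic_def bilinear_conv_bounded_bilinear by blast
  obtain k where k: "bounded_bilinear k" "\<And>x. Q x = k x x"
    using Q unfolding homogeneous_quadratic_def bilinear_conv_bounded_bilinear by blast
  interpret b: bounded_bilinear b by (fact b)
  interpret k: bounded_bilinear k by (fact k)
  have A': "(A has_derivative A) (at 0)"
    using A by (simp add: linear_conv_bounded_linear bounded_linear_imp_has_derivative)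
  have B': "(B has_derivative (\<lambda>_. 0)) (at 0)"
    using b.FDERIV[OF has_derivative_ident has_derivative_ident, of 0 UNIV]
    by (simp add: b(2)[abs_def] b.zero_left b.zero_right)
  have Q': "(Q has_derivative (\<lambda>_. 0)) (at 0)"
    using k.FDERIV[OF has_derivative_ident has_derivative_ident, of 0 UNIV]
    by (simp add: k(2)[abs_def] k.zero_left k.zero_right)
  have 0: "B 0 = 0" "Q 0 = 0" "A 0 = 0" using linear_0[OF A] by (simp_all add: b k b.zero_left k.zero_left)
  have "((\<lambda>x. (1 / (1 + Q x))) has_derivative (\<lambda>_. 0)) (at 0)"
    by (rule derivative_eq_intros Q' refl | simp add: 0)+
  from has_derivative_scaleR[OF this has_derivative_add[OF A' B']]
  show ?thesis by (simp add: 0)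
qed

theorem theorem5p3:
  fixes \<Phi> :: "real^'m \<Rightarrow> real^'n"
  assumes "rounding \<Phi>" and "\<not> degenerate \<Phi>"
  shows "\<exists>\<Psi> :: real^'m \<Rightarrow> real^'n. rounding \<Psi> \<and> equivalent_roundings \<Phi> \<Psi> \<and>
           (\<exists>f :: (real^'m) \<times> real \<Rightarrow> (real^'n) \<times> real.
              quadratic_sphere_map f \<and> germ_factors_through \<Psi> f)"
proof -
  from assms(1) obtain c r where "rounding_series \<Phi> c r"
    unfolding rounding_series_def rounding_def real_analytic_at_0_def monomial_at_def by blast
  then interpret rounding_series \<Phi> c r .
  obtain p q where p: "linear p" and q: "homogeneous_quadratic q"
    and AB: "\<And>x. H 1 x \<bullet> H 2 x = p x * (H 1 x \<bullet> H 1 x)"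
    and BB: "\<And>x. H 2 x \<bullet> H 2 x = q x * (H 1 x \<bullet> H 1 x)"
    by (rule ex_quotients) blast
  define B where "B x = H 2 x - p x *\<^sub>R H 1 x" for x
  define Q where "Q x = q x - (p x)\<^sup>2" for x
  have quad_B: "homogeneous_quadratic B"
    unfolding B_def by (intro homogeneous_quadratic_diff homogeneous_quadratic_linear_scaleR
        quadratic_homogeneous_part p linear_H1)
  have quad_Q: "homogeneous_quadratic Q"
    unfolding Q_def power2_eq_square
    using homogeneous_quadratic_diff[OF q homogeneous_quadratic_linear_scaleR[OF p p]] by simp
  have A_B: "H 1 x \<bullet> B x = 0" for x
    by (simp add: B_def inner_diff_right AB del: One_nat_def)
  have B_B: "B x \<bullet> B x = Q x * (H 1 x \<bullet> H 1 x)" for x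
  proof -
    have "B x \<bullet> B x = H 2 x \<bullet> H 2 x - 2 * p x * (H 1 x \<bullet> H 2 x) + (p x)\<^sup>2 * (H 1 x \<bullet> H 1 x)"
      by (simp add: B_def inner_diff inner_commute power2_eq_square algebra_simps del: One_nat_def)
    then show ?thesis by (simp add: AB BB Q_def power2_eq_square algebra_simps del: One_nat_def)
  qed
  have Q_off: "Q x \<ge> 0" if "H 1 x \<noteq> 0" for x
  proof -
    have "0 < H 1 x \<bullet> H 1 x" using that unfolding inner_gt_zero_iff .
    moreover have "0 \<le> Q x * (H 1 x \<bullet> H 1 x)" unfolding B_B[symmetric] by (rule inner_ge_zero)
    ultimately show ?thesis by (metis mult_neg_pos not_less)
  qed
  obtain e where e: "H 1 e \<noteq> 0"
    using ex_unit_image_and_independent[OF linear_H1 rank] by (metis inner_zero_left zero_neq_one)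
  \<comment> \<open>At zeros of the linear part, move in the direction \<open>e\<close>: nearby
    points have nonzero image, where \<open>Q\<close> is nonnegative. Continuity of
    \<open>min Q 0\<close> carries this to the limit.\<close>
  have Q_nonneg: "Q x \<ge> 0" for x
  proof (cases "H 1 x = 0")
    case True
    have cont: "continuous_on UNIV (\<lambda>t. Q (x + t *\<^sub>R e))"
      by (rule continuous_on_compose2[OF continuous_on_homogeneous_quadratic[OF quad_Q]])
        (auto intro!: continuous_intros)
    have "min (Q (x + t *\<^sub>R e)) 0 = 0" if "t \<noteq> 0" for t
    proof -
      have "H 1 (x + t *\<^sub>R e) = t *\<^sub>R H 1 e"
        unfolding linear_add[OF linear_H1] linear_cmul[OF linear_H1] True by simp
      then have "H 1 (x + t *\<^sub>R e) \<noteq> 0" using e that by simp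
      from Q_off[OF this] show ?thesis by simp
    qed
    with cont have "min (Q (x + 0 *\<^sub>R e)) 0 = 0"
      by (intro eq_at_0_if_eq_off_0[where f = "\<lambda>t. min (Q (x + t *\<^sub>R e)) 0" and g = "\<lambda>_. 0"]
          continuous_on_min continuous_on_const)
    then show ?thesis by (simp add: min_def split: if_splits)
  qed (rule Q_off)
  \<comment> \<open>Here nondegeneracy enters: a zero of \<open>Q\<close> in the kernel would be a
    degenerate point.\<close>
  have Q_pos: "Q x \<noteq> 0" if "x \<noteq> 0" "H 1 x = 0" for x
  proof
    assume "Q x = 0"
    then have "q x = (p x)\<^sup>2" by (simp add: Q_def)
    with that two_jet p q AB BB have "degenerate \<Phi>" unfolding degenerate_def by blast
    with assms(2) show False ..
  qed
  interpret sphere_lift "H 1" B Q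
    by (rule sphere_lift.intro) (fact linear_H1 quad_B quad_Q A_B B_B Q_nonneg Q_pos)+
  define \<Psi> where "\<Psi> x = (1 / (1 + Q x)) *\<^sub>R (H 1 x + B x)" for x
  have common: "\<exists>S. is_circle S \<and> germ_image_in \<Phi> l S \<and> germ_image_in \<Psi> l S" if l: "vector_line l" for l
  proof -
    obtain x where x: "x \<noteq> 0" "l = span {x}" using l by (rule vector_line_cases)
    obtain S where S: "is_circle S" "germ_image_in \<Phi> (span {x}) S" using x(1) by (rule ex_circle)
    have "\<Psi> (t *\<^sub>R x) \<in> S" for t
    proof (cases "H 1 x = 0")
      \<comment> \<open>Here \<open>B x\<close> vanishes too, so the new map collapses the whole
        line to 0, which lies on \<open>S\<close> because \<open>\<Phi> 0 = 0\<close>.\<close>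
      case True
      then have "B x = 0" using B_B[of x] by simp
      then have "\<Psi> (t *\<^sub>R x) = 0"
        using True by (simp add: \<Psi>_def homogeneous_part_scaleR homogeneous_quadratic_scaleR[OF quad_B])
      moreover have "0 \<in> S"
        using S(2) eventually_nhds_x_imp_x[of _ 0] \<Phi>_0 span_zero unfolding germ_image_in_def by fastforce
      ultimately show ?thesis by simp
    next
      case False
      have "\<Psi> (t *\<^sub>R x) = (1 / (1 + t\<^sup>2 * Q x)) *\<^sub>R (t *\<^sub>R H 1 x + t\<^sup>2 *\<^sub>R B x)"
        by (simp add: \<Psi>_def linear_cmul[OF linear_H1] homogeneous_quadratic_scaleR[OF quad_B]
            homogeneous_quadratic_scaleR[OF quad_Q] del: One_nat_def)
      \<comment> \<open>The multiple of the velocity removed from the second-order term is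
        \<open>p x\<close>.\<close>
      also have "\<dots> \<in> S"
        using curve_on_circle.rational_point_mem[OF curve_on_circle_line[OF False S] B_def A_B B_B Q_nonneg] .
      finally show ?thesis .
    qed
    then have "\<And>y. y \<in> l \<Longrightarrow> \<Psi> y \<in> S" by (auto simp: x(2) span_singleton)
    then have "germ_image_in \<Psi> l S" by (simp add: germ_image_in_def)
    with S x(2) show ?thesis by blast
  qed
  have "dim (range (frechet_derivative \<Psi> (at 0))) \<ge> 2"
    using rank frechet_derivative_at[OF rational_has_derivative[OF linear_H1 quad_B quad_Q]]
    by (simp add: \<Psi>_def[abs_def])
  moreover have "real_analytic_at_0 \<Psi>"
    unfolding real_analytic_at_0_iff \<Psi>_def
    by (rule power_series_at_0_quadratic_rational[OF linear_H1 quad_B quad_Q])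
  moreover have "\<Psi> 0 = 0"
    using homogeneous_quadratic_scaleR[OF quad_B, of 0 0] linear_0[OF linear_H1] by (simp add: \<Psi>_def)
  ultimately have "rounding \<Psi>" using common unfolding rounding_def by blast
  moreover have "equivalent_roundings \<Phi> \<Psi>" using common unfolding equivalent_roundings_def by blast
  ultimately show ?thesis using factors_through_quadratic unfolding \<Psi>_def[symmetric] by blast
qed

end
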